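(* Let $\mathcal{X}$ be a Polish space and $P\in\mathcal{P}(\mathcal{X})$. Let $\mathcal{L}:\mathcal{X}\to[-\infty,\infty)$ be a measurable function such that either (a) $\mathcal{L}$ is bounded below, or (b) $\mathcal{L}$ is bounded above and $\mathcal{L}^-\in L^1(P)$ (where $\mathcal{L}^-$ is the negative part of $\mathcal{L}$). Let $D$ be a pre-divergence such that $Q\mapsto D(Q\|P)$ is convex, and let $c$ be a cost function with $c(x,x)=0$ for all $x\in\mathcal{X}$. Then for all $\epsilon>0$ and $\kappa\geq 0$, \[ \sup_{Q\in\mathcal{P}(\mathcal{X}):D^c(Q\|P)\leq \epsilon}\{E_Q[\mathcal{L}]-\kappa D^c(Q\|P)\} =\inf_{\lambda>0}\Big\{\lambda \epsilon+(\lambda+\kappa)\sup_{Q\in\mathcal{P}(\mathcal{X}):D(Q\|P)<\infty}\{E_{Q}[ \mathcal{L}_{\lambda+\kappa}^c]- D(Q\|P)\}\Big\}. \]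
   Context: $\mathcal{X}$ is a Polish space with its Borel $\sigma$-algebra; $\mathcal{P}(\mathcal{X})$ is the set of Borel probability measures on $\mathcal{X}$ with the topology of weak convergence. A pre-divergence is a map $D:\mathcal{P}(\mathcal{X})\times\mathcal{P}(\mathcal{X})\to[0,\infty]$ with $D(\mu\|\mu)=0$ for all $\mu$. A cost function is a lower semicontinuous $c:\mathcal{X}\times\mathcal{X}\to[0,\infty]$; its optimal transport cost is $C(\mu,\nu)=\inf\{\int c\,d\pi:\pi\in\mathcal{P}(\mathcal{X}\times\mathcal{X}),\pi_1=\mu,\pi_2=\nu\}$ ($\pi_i$ the marginals). The OT-regularized divergence is $D^c(\nu\|\mu)=\inf_{\eta\in\mathcal{P}(\mathcal{X})}\{D(\eta\|\mu)+C(\eta,\nu)\}$. For $\lambda>0$ the OT-regularized loss is $\mathcal{L}^c_\lambda(x)=\sup_{y\in\mathcal{X}}\{\mathcal{L}(y)/\lambda-c(x,y)\}$; it is universally measurable and expectations of it are taken with respect to the completion of the measure. *)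

theory Defs
  imports "HOL-Probability.Probability"
begin

definition Prob :: "('a::topological_space) measure set" where
  "Prob = {M. sets M = sets borel \<and> prob_space M}"

definition pre_divergence :: "('a::topological_space measure \<Rightarrow> 'a measure \<Rightarrow> ennreal) \<Rightarrow> bool" where
  "pre_divergence D \<longleftrightarrow> (\<forall>\<mu>\<in>Prob. D \<mu> \<mu> = 0)"

definition mixture :: "real \<Rightarrow> 'a::topological_space measure \<Rightarrow> 'a measure \<Rightarrow> 'a measure" where
  "mixture t Q1 Q2 = measure_of UNIV (sets borel)
      (\<lambda>A. ennreal t * emeasure Q1 A + ennreal (1 - t) * emeasure Q2 A)"

definition convex_in_first :: "('a::topological_space measure \<Rightarrow> 'a measure \<Rightarrow> ennreal) \<Rightarrow> 'a measure \<Rightarrow> bool" where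
  "convex_in_first D P \<longleftrightarrow> (\<forall>Q1\<in>Prob. \<forall>Q2\<in>Prob. \<forall>t\<in>{0..1}.
      D (mixture t Q1 Q2) P \<le> ennreal t * D Q1 P + ennreal (1 - t) * D Q2 P)"

definition cost_function :: "('a::topological_space \<Rightarrow> 'a \<Rightarrow> ennreal) \<Rightarrow> bool" where
  "cost_function c \<longleftrightarrow> (\<forall>t. closed {p::'a \<times> 'a. c (fst p) (snd p) \<le> t})"

definition couplings :: "'a::topological_space measure \<Rightarrow> 'a measure \<Rightarrow> ('a \<times> 'a) measure set" where
  "couplings \<mu> \<nu> = {\<pi>. sets \<pi> = sets (borel :: ('a \<times> 'a) measure) \<and> prob_space \<pi> \<and>
      distr \<pi> borel fst = \<mu> \<and> distr \<pi> borel snd = \<nu>}"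

definition OT_cost :: "('a::topological_space \<Rightarrow> 'a \<Rightarrow> ennreal) \<Rightarrow> 'a measure \<Rightarrow> 'a measure \<Rightarrow> ennreal" where
  "OT_cost c \<mu> \<nu> = (INF \<pi>\<in>couplings \<mu> \<nu>. \<integral>\<^sup>+ p. c (fst p) (snd p) \<partial>\<pi>)"

definition OT_reg_div :: "('a::topological_space measure \<Rightarrow> 'a measure \<Rightarrow> ennreal) \<Rightarrow>
    ('a \<Rightarrow> 'a \<Rightarrow> ennreal) \<Rightarrow> 'a measure \<Rightarrow> 'a measure \<Rightarrow> ennreal" where
  "OT_reg_div D c \<nu> \<mu> = (INF \<eta>\<in>Prob. D \<eta> \<mu> + OT_cost c \<eta> \<nu>)"

definition OT_reg_loss :: "('a \<Rightarrow> ereal) \<Rightarrow> ('a \<Rightarrow> 'a \<Rightarrow> ennreal) \<Rightarrow> real \<Rightarrow> 'a \<Rightarrow> ereal" where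
  "OT_reg_loss L c lam x = (SUP y. L y / ereal lam - enn2ereal (c x y))"

definition expect :: "'a measure \<Rightarrow> ('a \<Rightarrow> ereal) \<Rightarrow> ereal" where
  "expect M f = enn2ereal (\<integral>\<^sup>+ x. e2ennreal (f x) \<partial>M) - enn2ereal (\<integral>\<^sup>+ x. e2ennreal (- f x) \<partial>M)"

end

theory Submission
  imports Defs
begin

text \<open>
  Weak duality is the inequality \<open>L y / (\<lambda> + \<kappa>) - c x y \<le> OT_reg_loss L c (\<lambda> + \<kappa>) x\<close> integrated
  against a coupling. For the converse, consider all couplings \<open>\<pi>\<close> whose first marginal has finite
  divergence and whose transport cost is finite. To \<open>\<pi>\<close> with marginals \<open>\<eta>\<close>, \<open>Q\<close> assign the point
  \<open>(g, E_Q[L] - \<kappa> g)\<close> with \<open>g = D \<eta> P + \<integral> c d\<pi>\<close>. By convexity of \<open>D\<close> mixtures of couplings make this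
  set of points convex up to domination, and the diagonal coupling of \<open>P\<close> has \<open>g = 0 < \<epsilon>\<close>, so a
  separating line exists and its slope is the multiplier \<open>\<lambda>\<close>. The supremum over couplings with first
  marginal \<open>\<eta>\<close> is then turned into \<open>E_\<eta>[OT_reg_loss L c (\<lambda> + \<kappa>)]\<close> by a measurable selection of
  almost optimal \<open>y\<close>. The selection theorem rests on three facts: Borel sets are projections
  of closed sets, projections of closed sets can be exhausted in measure by projections along compact
  sets, and the latter admit Borel selectors.
\<close>

subsection \<open>Measurable projection and selection\<close>

text \<open>Analytic sets as projections of closed sets. The auxiliary factor consists of real
  sequences because this space is Polish, as \<open>capacity_compact\<close> and
  \<open>compact_selection\<close> demand, and because one sequence can store countably many
  others.\<close>

definition analytic :: "'w::topological_space set \<Rightarrow> bool" where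
  "analytic B \<longleftrightarrow> (\<exists>C :: ('w \<times> (nat \<Rightarrow> real)) set. closed C \<and> B = fst ` C)"

lemma analytic_closed:
  assumes "closed B"
  shows "analytic B"
  unfolding analytic_def
  by (rule exI[of _ "B \<times> UNIV"]) (auto intro!: closed_Times assms)

text \<open>Reading off a subfamily of coordinates is continuous. This allows a single auxiliary
  sequence to carry several witnesses in \<open>analytic_INT\<close> and
  \<open>analytic_UN\<close>.\<close>

lemma closed_vimage_reparam:
  fixes C :: "('w::topological_space \<times> (nat \<Rightarrow> real)) set" and h :: "nat \<Rightarrow> nat"
  assumes "closed C"
  shows "closed {p. (fst p, \<lambda>k. snd p (h k)) \<in> C}"
proof -
  have "continuous_on UNIV (\<lambda>p::'w \<times> (nat \<Rightarrow> real). (fst p, \<lambda>k. snd p (h k)))"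
    by (intro continuous_intros continuous_on_compose2[OF continuous_on_product_coordinates])
      auto
  from closed_vimage[OF assms this] show ?thesis
    by (simp add: vimage_def)
qed

lemma closed_coordinate:
  fixes S :: "real set"
  assumes "closed S"
  shows "closed {p :: 'w::topological_space \<times> (nat \<Rightarrow> real). snd p k \<in> S}"
proof -
  have "continuous_on UNIV (\<lambda>p::'w \<times> (nat \<Rightarrow> real). snd p k)"
    by (rule continuous_on_compose2[of UNIV "\<lambda>x. x k" UNIV snd]) (auto intro: continuous_intros)
  from closed_vimage[OF assms this] show ?thesis
    by (simp add: vimage_def)
qed

text \<open>The auxiliary sequence is arranged as a matrix through \<open>prod_encode\<close>, and
  row \<open>n\<close> holds the witness for \<open>C n\<close>. All rows share the same first
  component, so intersecting the pulled-back closed sets intersects the projections.\<close>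

lemma analytic_INT:
  assumes "\<And>n::nat. analytic (B n)"
  shows "analytic (\<Inter>n. B n)"
proof -
  obtain C :: "nat \<Rightarrow> ('a \<times> (nat \<Rightarrow> real)) set"
    where C: "\<And>n. closed (C n)" "\<And>n. B n = fst ` C n"
    using assms unfolding analytic_def by metis
  let ?D = "\<Inter>n. {p. (fst p, \<lambda>k. snd p (prod_encode (n, k))) \<in> C n}"
  have "closed ?D"
    using C by (intro closed_INT ballI closed_vimage_reparam)
  moreover have "(\<Inter>n. B n) = fst ` ?D"
  proof (intro equalityI subsetI)
    fix x assume "x \<in> (\<Inter>n. B n)"
    then have "\<forall>n. \<exists>s. (x, s) \<in> C n"
      using C(2) by force
    then obtain s where s: "\<And>n. (x, s n) \<in> C n" by metis
    let ?t = "\<lambda>j. s (fst (prod_decode j)) (snd (prod_decode j))"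
    have "(x, ?t) \<in> ?D" using s by simp
    then show "x \<in> fst ` ?D" by (rule rev_image_eqI) simp
  next
    fix x assume "x \<in> fst ` ?D"
    then obtain s where "(x, s) \<in> ?D" by auto
    then have "(x, \<lambda>k. s (prod_encode (n, k))) \<in> C n" for n by simp
    then show "x \<in> (\<Inter>n. B n)" unfolding C(2) by (intro INT_I) (rule rev_image_eqI, auto)
  qed
  ultimately show ?thesis
    unfolding analytic_def by blast
qed

lemma analytic_UN:
  assumes "\<And>n::nat. analytic (B n)"
  shows "analytic (\<Union>n. B n)"
proof -
  obtain C :: "nat \<Rightarrow> ('a \<times> (nat \<Rightarrow> real)) set"
    where C: "\<And>n. closed (C n)" "\<And>n. B n = fst ` C n"
    using assms unfolding analytic_def by metis
  \<comment> \<open>The coordinate \<open>snd p 0\<close> selects the index of the union. Writing the set as an intersection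
    makes closedness immediate.\<close>
  let ?D = "{p. snd p 0 \<in> \<nat>} \<inter>
    (\<Inter>n. {p. snd p 0 \<in> {..real n - 1} \<union> {real n + 1..}} \<union> {p. (fst p, \<lambda>k. snd p (Suc k)) \<in> C n})"
  have "closed ?D"
    using C
    by (intro closed_Int closed_INT ballI closed_Un closed_vimage_reparam closed_coordinate) auto
  moreover have "(\<Union>n. B n) = fst ` ?D"
  proof (intro equalityI subsetI)
    fix x assume "x \<in> (\<Union>n. B n)"
    then obtain m s where s: "(x, s) \<in> C m"
      using C(2) by force
    let ?t = "\<lambda>j. case j of 0 \<Rightarrow> real m | Suc k \<Rightarrow> s k"
    have "(x, ?t) \<in> ?D"
    proof (intro IntI INT_I)
      fix n :: nat
      show "(x, ?t) \<in> {p. snd p 0 \<in> {..real n - 1} \<union> {real n + 1..}} \<union> {p. (fst p, \<lambda>k. snd p (Suc k)) \<in> C n}"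
        using s by (cases m n rule: linorder_cases) auto
    qed auto
    then show "x \<in> fst ` ?D" by (rule rev_image_eqI) simp
  next
    fix x assume "x \<in> fst ` ?D"
    then obtain s where "(x, s) \<in> ?D" by auto
    then have "s 0 \<in> \<nat>"
      and *: "\<And>n. s 0 \<in> {..real n - 1} \<union> {real n + 1..} \<or> (x, \<lambda>k. s (Suc k)) \<in> C n"
      by auto
    then obtain m where "s 0 = real m" by (auto elim: Nats_cases)
    with *[of m] have "(x, \<lambda>k. s (Suc k)) \<in> C m" by auto
    then show "x \<in> (\<Union>n. B n)" unfolding C(2) by (intro UN_I[of m] UNIV_I) (rule rev_image_eqI, auto)
  qed
  ultimately show ?thesis
    unfolding analytic_def by blast
qed

text \<open>In a metric space an open set is a countable union of closed sets: the points at
  distance at least 1/(n+1) from the complement.\<close>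

lemma analytic_open:
  fixes U :: "'w::metric_space set"
  assumes "open U"
  shows "analytic U"
proof -
  have eq: "U = (\<Union>n. {x. \<forall>y\<in>-U. inverse (real (Suc n)) \<le> dist x y})"
  proof (intro equalityI subsetI)
    fix x assume "x \<in> U"
    then obtain e where e: "e > 0" "ball x e \<subseteq> U"
      using assms open_contains_ball by blast
    obtain n where n: "inverse (real (Suc n)) < e"
      using reals_Archimedean[OF e(1)] by auto
    have "inverse (real (Suc n)) \<le> dist x y" if "y \<in> -U" for y
    proof -
      have "y \<notin> ball x e" using that e(2) by blast
      with n show ?thesis by simp
    qed
    then show "x \<in> (\<Union>n. {x. \<forall>y\<in>-U. inverse (real (Suc n)) \<le> dist x y})" by blast
  next
    fix x assume "x \<in> (\<Union>n. {x. \<forall>y\<in>-U. inverse (real (Suc n)) \<le> dist x y})"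
    then obtain n where n: "\<And>y. y \<in> -U \<Longrightarrow> inverse (real (Suc n)) \<le> dist x y" by blast
    show "x \<in> U"
    proof (rule ccontr)
      assume "x \<notin> U"
      then have "inverse (real (Suc n)) \<le> dist x x" using n[of x] by blast
      then show False by simp
    qed
  qed
  have "closed {x. \<forall>y\<in>-U. inverse (real (Suc n)) \<le> dist x y}" for n
    unfolding Collect_ball_eq by (intro closed_INT ballI closed_Collect_le continuous_intros)
  then show ?thesis
    by (subst eq) (intro analytic_UN analytic_closed)
qed

lemma analytic_borel:
  fixes B :: "'w::metric_space set"
  assumes "B \<in> sets borel"
  shows "analytic B"
proof -
  have "B \<in> sigma_sets UNIV {S. open S}"
    using assms by (simp add: borel_def)
  \<comment> \<open>Analytic sets are not closed under complements in general. Carrying the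
    complement along turns the case \<open>Compl\<close> into a swap and the case
    \<open>Union\<close> into one union and one intersection.\<close>
  then have "analytic B \<and> analytic (- B)"
  proof induction
    case (Basic a)
    then show ?case by (auto intro: analytic_open analytic_closed)
  next
    case Empty
    then show ?case by (auto intro: analytic_closed)
  next
    case (Compl a)
    then show ?case by (simp flip: Compl_eq_Diff_UNIV)
  next
    case (Union a)
    then show ?case by (auto simp: uminus_Sup image_image intro!: analytic_UN analytic_INT)
  qed
  then show ?thesis by simp
qed

section \<open>Approximating projections in measure along compact sets\<close>

lemma compact_totally_boundedI:
  fixes S :: "'v::complete_space set"
  assumes "closed S" and "\<And>e. e > 0 \<Longrightarrow> \<exists>F. finite F \<and> S \<subseteq> (\<Union>x\<in>F. cball x e)"
  shows "compact S"
  unfolding compact_eq_totally_bounded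
proof (intro conjI allI impI, goal_cases)
  case 1
  show ?case using assms(1) by (simp add: complete_eq_closed)
next
  case (2 e)
  with assms(2)[of "e/2"] obtain F where F: "finite F" "S \<subseteq> (\<Union>x\<in>F. cball x (e/2))" by auto
  moreover have "cball x (e/2) \<subseteq> ball x e" for x :: 'v
    using 2 by auto
  ultimately show ?case
    by (intro exI[of _ F]) blast
qed

text \<open>Compactness of \<open>K\<close> gives a convergent subsequence of second components, and
  closedness of \<open>C\<close> keeps the limit pair.\<close>

lemma closed_proj_compact:
  fixes C :: "('x::metric_space \<times> 'v::metric_space) set"
  assumes C: "closed C" and K: "compact K"
  shows "closed (fst ` (C \<inter> UNIV \<times> K))"
proof (unfold closed_sequential_limits, intro allI impI, elim conjE)
  fix x l assume "\<forall>n. x n \<in> fst ` (C \<inter> UNIV \<times> K)" and lim: "x \<longlonglongrightarrow> l"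
  then have "\<forall>n. \<exists>v. v \<in> K \<and> (x n, v) \<in> C" by force
  then obtain v where v: "\<And>n. v n \<in> K" "\<And>n. (x n, v n) \<in> C" by metis
  obtain w r where w: "w \<in> K" "strict_mono (r::nat\<Rightarrow>nat)" "(v \<circ> r) \<longlonglongrightarrow> w"
    using K v(1) unfolding compact_def by metis
  have "(\<lambda>n. (x (r n), v (r n))) \<longlonglongrightarrow> (l, w)"
    using w(3) LIMSEQ_subseq_LIMSEQ[OF lim w(2)] by (intro tendsto_Pair) (auto simp: o_def)
  then have "(l, w) \<in> C"
    using C v(2) by (meson closed_sequentially)
  with w(1) show "l \<in> fst ` (C \<inter> UNIV \<times> K)" by force
qed

lemma dense_sequence:
  obtains d :: "nat \<Rightarrow> 'v::{metric_space, second_countable_topology}"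
  where "\<And>v e. e > 0 \<Longrightarrow> \<exists>i. dist v (d i) \<le> e"
proof -
  obtain D :: "'v set" where D: "countable D" "\<And>X. open X \<Longrightarrow> X \<noteq> {} \<Longrightarrow> \<exists>d \<in> D. d \<in> X"
    using countable_dense_exists[where 'a='v] by auto
  then have "D \<noteq> {}" by (metis UNIV_not_empty empty_iff open_UNIV)
  show thesis
  proof (rule that)
    fix v :: 'v and e :: real assume "e > 0"
    then obtain x where "x \<in> D" "x \<in> ball v e"
      using D(2)[of "ball v e"] by auto
    moreover obtain i where "from_nat_into D i = x"
      using from_nat_into_surj[OF D(1) \<open>x \<in> D\<close>] by blast
    ultimately show "\<exists>i. dist v (from_nat_into D i) \<le> e"
      by (intro exI[of _ i]) simp
  qed
qed

text \<open>A case of Choquet capacitability. At stage \<open>j\<close> the second coordinate is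
  restricted to finitely many balls of radius (1/2)^j, at a loss of at most e (1/2)^(j+1) in outer
  measure. The restrictions together confine it to a closed totally bounded set
  \<open>K\<close>.\<close>

lemma capacity_compact:
  fixes C :: "('x::metric_space \<times> 'v::{complete_space, second_countable_topology}) set"
  assumes C: "closed C" and M: "finite_measure M" and sets_M: "sets M = sets borel" and e: "e > 0"
  obtains K where "compact K"
    and "outer_measure_of M (fst ` C) \<le> emeasure M (fst ` (C \<inter> UNIV \<times> K)) + ennreal e"
proof -
  interpret finite_measure M by fact
  have space_M: "space M = UNIV"
    using sets_eq_imp_space_eq[OF sets_M] by simp
  obtain d :: "nat \<Rightarrow> 'v" where d: "\<And>v e. e > 0 \<Longrightarrow> \<exists>i. dist v (d i) \<le> e"
    using dense_sequence by metis
  define U where "U j n = (\<Union>i\<le>n. cball (d i) ((1/2)^j))" for j n :: nat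
  have U_closed: "closed (U j n)" for j n
    unfolding U_def by (intro closed_UN) auto
  let ?\<mu> = "outer_measure_of M"
  have \<mu>_fin: "?\<mu> A < \<infinity>" for A
  proof -
    have "?\<mu> A \<le> ?\<mu> (space M)" by (intro outer_measure_of_mono) (auto simp: space_M)
    also have "\<dots> < \<infinity>" by (simp add: less_top[symmetric])
    finally show ?thesis .
  qed
  \<comment> \<open>Outer measure is continuous along increasing sequences of arbitrary sets, so the
    argument also covers projections not known to be measurable.\<close>
  have step: "\<exists>n. ?\<mu> (fst ` S) \<le> ?\<mu> (fst ` (S \<inter> UNIV \<times> U j n)) + ennreal (e * (1/2)^Suc j)"
    for S :: "('x \<times> 'v) set" and j
  proof -
    let ?A = "\<lambda>n. fst ` (S \<inter> UNIV \<times> U j n)"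
    have U: "(\<Union>n. U j n) = UNIV"
      using d[of "(1/2)^j"] by (auto simp: U_def dist_commute) fastforce
    have "incseq ?A"
      by (intro incseq_SucI image_mono) (auto simp: U_def intro: le_SucI)
    then have "(SUP n. ?\<mu> (?A n)) = ?\<mu> (\<Union>n. ?A n)"
      by (intro SUP_outer_measure_of_incseq) (auto simp: space_M)
    also have "(\<Union>n. ?A n) = fst ` S"
    proof -
      have "(\<Union>n. ?A n) = fst ` (S \<inter> UNIV \<times> (\<Union>n. U j n))" by blast
      then show ?thesis by (simp add: U)
    qed
    finally have eq: "(SUP n. ?\<mu> (?A n)) = ?\<mu> (fst ` S)" .
    have pos: "0 < ennreal (e * (1/2)^Suc j)"
      using e by simp
    have "\<exists>n\<in>UNIV. (SUP n. ?\<mu> (?A n)) < ?\<mu> (?A n) + ennreal (e * (1/2)^Suc j)"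
      using pos \<mu>_fin by (intro SUP_approx_ennreal) (auto simp: eq less_top)
    with eq show ?thesis by (auto intro: less_imp_le)
  qed
  define nn where "nn S j = (SOME n. ?\<mu> (fst ` S) \<le> ?\<mu> (fst ` (S \<inter> UNIV \<times> U j n)) + ennreal (e * (1/2)^Suc j))"
    for S :: "('x \<times> 'v) set" and j
  define S where "S = rec_nat C (\<lambda>j S. S \<inter> UNIV \<times> U j (nn S j))"
  define m where "m j = nn (S j) j" for j
  have S_0: "S 0 = C" and S_Suc: "S (Suc j) = S j \<inter> UNIV \<times> U j (m j)" for j
    by (auto simp: S_def m_def)
  have S_eq: "S k = C \<inter> UNIV \<times> (\<Inter>j<k. U j (m j))" for k
    by (induction k) (auto simp: S_0 S_Suc lessThan_Suc)
  have S_step: "?\<mu> (fst ` S j) \<le> ?\<mu> (fst ` S (Suc j)) + ennreal (e * (1/2)^Suc j)" for j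
    unfolding S_Suc m_def nn_def using someI_ex[OF step] by blast
  \<comment> \<open>The losses e/2 + e/4 + ... of the first \<open>k\<close> stages sum to e (1 -
    (1/2)^k).\<close>
  have S_lower: "?\<mu> (fst ` C) \<le> ?\<mu> (fst ` S k) + ennreal (e * (1 - (1/2)^k))" for k
  proof (induction k)
    case (Suc k)
    have "?\<mu> (fst ` C) \<le> (?\<mu> (fst ` S (Suc k)) + ennreal (e * (1/2)^Suc k)) + ennreal (e * (1 - (1/2)^k))"
      using Suc S_step[of k] by (meson add_right_mono order_trans)
    also have "\<dots> = ?\<mu> (fst ` S (Suc k)) + ennreal (e * (1/2)^Suc k + e * (1 - (1/2)^k))"
      using e by (simp add: add.assoc power_le_one ennreal_plus)
    also have "e * (1/2)^Suc k + e * (1 - (1/2)^k) = e * (1 - (1/2)^Suc k)"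
      by (simp add: algebra_simps)
    finally show ?case .
  qed (simp add: S_0)
  define K where "K = (\<Inter>j. U j (m j))"
  \<comment> \<open>The finite set \<open>G\<close> admits exceptional points. For \<open>K\<close>
    it is empty; for the sequence \<open>v\<close> below it collects the initial terms.\<close>
  have cov: "\<exists>F. finite F \<and> T \<subseteq> (\<Union>x\<in>F. cball x r)"
    if T: "\<And>j. \<exists>G. finite G \<and> T \<subseteq> G \<union> U j (m j)" and r: "r > 0" for T and r :: real
  proof -
    obtain j where j: "(1/2)^j < r"
      using real_arch_pow_inv[OF r, of "1/2"] by auto
    obtain G where G: "finite G" "T \<subseteq> G \<union> U j (m j)" using T by blast
    have "T \<subseteq> (\<Union>x\<in>G \<union> d ` {..m j}. cball x r)"
    proof
      fix v assume "v \<in> T"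
      with G consider "v \<in> G" | i where "i \<le> m j" "dist (d i) v \<le> (1/2)^j"
        by (auto simp: U_def)
      then show "v \<in> (\<Union>x\<in>G \<union> d ` {..m j}. cball x r)"
      proof cases
        case 1
        with r have "v \<in> cball v r" by auto
        with 1 show ?thesis by blast
      next
        case 2
        with j have "v \<in> cball (d i) r" by auto
        with 2 show ?thesis by blast
      qed
    qed
    with G show ?thesis by (intro exI[of _ "G \<union> d ` {..m j}"]) auto
  qed
  have K: "compact K"
  proof (rule compact_totally_boundedI)
    show "closed K" unfolding K_def using U_closed by (intro closed_INT) auto
    show "\<exists>F. finite F \<and> K \<subseteq> (\<Union>x\<in>F. cball x r)" if "r > 0" for r
      by (rule cov[OF _ that]) (auto simp: K_def intro!: exI[of _ "{}"])
  qed
  let ?D = "fst ` (C \<inter> UNIV \<times> K)"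
  \<comment> \<open>Outer measure need not be continuous along decreasing sequences, so the
    projections are replaced by their closures, which are measurable. The crux is that even the
    closures shrink into \<open>?D\<close>.\<close>
  have sub: "(\<Inter>k. closure (fst ` S k)) \<subseteq> ?D"
  proof
    fix x assume x: "x \<in> (\<Inter>k. closure (fst ` S k))"
    have "\<exists>y v. (y, v) \<in> S k \<and> dist y x < (1/2)^k" for k
    proof -
      have "x \<in> closure (fst ` S k)" using x by blast
      then obtain y where "y \<in> fst ` S k" "dist y x < (1/2)^k"
        unfolding closure_approachable by (meson half_gt_zero zero_less_one zero_less_power zero_less_divide_1_iff zero_less_numeral)
      then show ?thesis by force
    qed
    then obtain y v where yv: "\<And>k. (y k, v k) \<in> S k" "\<And>k. dist (y k) x < (1/2)^k" by metis
    have y: "y \<longlonglongrightarrow> x"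
    proof (rule metric_LIMSEQ_I)
      fix r :: real assume "r > 0"
      then obtain N where N: "(1/2)^N < r"
        using real_arch_pow_inv[of r "1/2"] by auto
      have "dist (y n) x < r" if "n \<ge> N" for n
      proof -
        have "(1/2::real)^n \<le> (1/2)^N" using that by (intro power_decreasing) auto
        with yv(2)[of n] N show ?thesis by linarith
      qed
      then show "\<exists>N. \<forall>n\<ge>N. dist (y n) x < r" by blast
    qed
    have vU: "v k \<in> U j (m j)" if "j < k" for j k
      using yv(1)[of k] that by (auto simp: S_eq)
    \<comment> \<open>The terms \<open>v k\<close> need not lie in \<open>K\<close>, but all terms
      with k > j lie in \<open>U j (m j)\<close>, so finitely many balls of each radius suffice for
      the whole sequence.\<close>
    have "compact (closure (range v))"
    proof (rule compact_totally_boundedI)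
      show "\<exists>F. finite F \<and> closure (range v) \<subseteq> (\<Union>x\<in>F. cball x r)" if "r > 0" for r
      proof (rule cov[OF _ that])
        fix j
        have "range v \<subseteq> v ` {..j} \<union> U j (m j)"
          using vU by (auto simp: image_iff) (metis atMost_iff not_le)
        then have "closure (range v) \<subseteq> v ` {..j} \<union> U j (m j)"
          by (rule closure_minimal) (use U_closed in \<open>auto intro: closed_Un finite_imp_closed\<close>)
        then show "\<exists>G. finite G \<and> closure (range v) \<subseteq> G \<union> U j (m j)"
          by (intro exI[of _ "v ` {..j}"]) auto
      qed
    qed auto
    then obtain w r where w: "strict_mono (r::nat\<Rightarrow>nat)" "(v \<circ> r) \<longlonglongrightarrow> w"
      unfolding compact_def using closure_subset by (metis range_subsetD)
    have "w \<in> U j (m j)" for j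
    proof (rule closed_sequentially[OF U_closed])
      show "(\<lambda>n. (v \<circ> r) (n + Suc j)) \<longlonglongrightarrow> w" by (rule LIMSEQ_ignore_initial_segment[OF w(2)])
      show "(v \<circ> r) (n + Suc j) \<in> U j (m j)" for n
        using seq_suble[OF w(1), of "n + Suc j"] by (auto intro!: vU)
    qed
    then have "w \<in> K" by (simp add: K_def)
    moreover have "(x, w) \<in> C"
    proof (rule closed_sequentially[OF C])
      show "(\<lambda>n. (y (r n), v (r n))) \<longlonglongrightarrow> (x, w)"
        using w(2) LIMSEQ_subseq_LIMSEQ[OF y w(1)] by (intro tendsto_Pair) (auto simp: o_def)
      show "(y (r n), v (r n)) \<in> C" for n
        using yv(1)[of "r n"] by (simp add: S_eq)
    qed
    ultimately show "x \<in> ?D" by force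
  qed
  have D_sets: "?D \<in> sets M"
    using closed_proj_compact[OF C K] by (simp add: sets_M)
  have cl: "closure (fst ` S k) \<in> sets M" for k
    by (simp add: sets_M)
  have "decseq (\<lambda>k. closure (fst ` S k))"
    by (intro decseq_SucI closure_mono image_mono) (auto simp: S_Suc)
  then have "(INF k. emeasure M (closure (fst ` S k))) = emeasure M (\<Inter>k. closure (fst ` S k))"
    using cl by (intro INF_emeasure_decseq) (auto simp: emeasure_finite)
  also have "\<dots> \<le> emeasure M ?D"
    using sub D_sets by (rule emeasure_mono)
  finally have INF: "(INF k. emeasure M (closure (fst ` S k))) \<le> emeasure M ?D" .
  have "?\<mu> (fst ` C) - ennreal e \<le> emeasure M (closure (fst ` S k))" for k
  proof -
    have "?\<mu> (fst ` C) \<le> ?\<mu> (fst ` S k) + ennreal (e * (1 - (1/2)^k))" by (rule S_lower)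
    also have "\<dots> \<le> ?\<mu> (closure (fst ` S k)) + ennreal e"
      using e by (intro add_mono outer_measure_of_mono closure_subset ennreal_leI) (simp add: mult_le_cancel_left1)
    also have "\<dots> = ennreal e + emeasure M (closure (fst ` S k))"
      using cl by (simp add: add.commute)
    finally show ?thesis
      by (simp add: ennreal_minus_le_iff)
  qed
  then have "?\<mu> (fst ` C) - ennreal e \<le> emeasure M ?D"
    using INF by (meson INF_greatest order_trans)
  then have "?\<mu> (fst ` C) \<le> emeasure M ?D + ennreal e"
    by (simp add: ennreal_minus_le_iff add.commute)
  with K that show thesis by blast
qed

text \<open>Successive approximation as in the theorem of Kuratowski and Ryll-Nardzewski. At stage
  \<open>n\<close> the least index is chosen whose ball of radius (1/2)^n meets the fibre over
  \<open>x\<close> inside \<open>K\<close> and whose centre is close to the previous one. Least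
  indices depend measurably on \<open>x\<close> since the sets \<open>R n i\<close> are closed, and
  the centres converge to a point of the fibre.\<close>

lemma compact_selection:
  fixes C :: "('x::metric_space \<times> 'v::{complete_space, second_countable_topology}) set"
  assumes C: "closed C" and K: "compact K"
  obtains T where "T \<in> borel_measurable borel" and "\<And>x. x \<in> fst ` (C \<inter> UNIV \<times> K) \<Longrightarrow> (x, T x) \<in> C"
proof -
  obtain d :: "nat \<Rightarrow> 'v" where d: "\<And>v e. e > 0 \<Longrightarrow> \<exists>i. dist v (d i) \<le> e"
    using dense_sequence by metis
  define R where "R n i = fst ` (C \<inter> UNIV \<times> (K \<inter> cball (d i) ((1/2)^n)))" for n i :: nat
  have R_closed: "closed (R n i)" for n i
    unfolding R_def using C K by (intro closed_proj_compact) (auto intro: compact_Int_closed)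
  let ?D = "fst ` (C \<inter> UNIV \<times> K)"
  have D_closed: "closed ?D" using C K by (rule closed_proj_compact)
  \<comment> \<open>The constant 2 suffices: a fibre point within (1/2)^n of the old centre lies
    within (1/2)^(n+1) of some new one, and the two distances add up to less than 2 (1/2)^n.\<close>
  define I where "I x = rec_nat (LEAST i. x \<in> R 0 i)
    (\<lambda>n k. LEAST i. x \<in> R (Suc n) i \<and> dist (d i) (d k) \<le> 2 * (1/2)^n)" for x
  have I_0: "I x 0 = (LEAST i. x \<in> R 0 i)"
    and I_Suc: "I x (Suc n) = (LEAST i. x \<in> R (Suc n) i \<and> dist (d i) (d (I x n)) \<le> 2 * (1/2)^n)" for x n
    by (auto simp: I_def)
  have [measurable]: "R n i \<in> sets borel" for n i using R_closed by auto
  have [measurable]: "(\<lambda>x. I x n) \<in> borel \<rightarrow>\<^sub>M count_space UNIV" for n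
  proof (induction n)
    case (Suc n)
    note [measurable] = Suc
    show ?case unfolding I_Suc by measurable
  qed (unfold I_0, measurable)
  have ex_near: "\<exists>i. dist v (d i) \<le> (1/2)^n" for v n
    using d by simp
  have IR: "x \<in> R n (I x n) \<and> dist (d (I x (Suc n))) (d (I x n)) \<le> 2 * (1/2)^n" if "x \<in> ?D" for x n
  proof -
    have next_ex: "\<exists>i. x \<in> R (Suc n) i \<and> dist (d i) (d k) \<le> 2 * (1/2)^n" if "x \<in> R n k" for n k
    proof -
      from that obtain v where v: "v \<in> K" "(x, v) \<in> C" "dist (d k) v \<le> (1/2)^n"
        by (auto simp: R_def)
      obtain i where i: "dist v (d i) \<le> (1/2)^Suc n" using ex_near by blast
      have "x \<in> R (Suc n) i"
        using v i by (force simp: R_def dist_commute)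
      moreover have "dist (d i) (d k) \<le> dist v (d i) + dist (d k) v"
        using dist_triangle[of "d i" "d k" v] by (simp add: dist_commute)
      then have "dist (d i) (d k) \<le> 2 * (1/2)^n"
        using v(3) i zero_le_power[of "1/2::real" n] by (simp only: power_Suc) linarith
      ultimately show ?thesis by blast
    qed
    have "x \<in> R n (I x n)" for n
    proof (induction n)
      case 0
      from \<open>x \<in> ?D\<close> obtain v where v: "v \<in> K" "(x, v) \<in> C" by auto
      obtain i where "dist v (d i) \<le> (1/2)^0" using ex_near by blast
      with v have "x \<in> R 0 i" by (force simp: R_def dist_commute)
      then show ?case unfolding I_0 by (rule LeastI)
    next
      case (Suc n)
      from LeastI_ex[OF next_ex[OF this]] show ?case unfolding I_Suc by blast
    qed
    moreover from LeastI_ex[OF next_ex[OF this[of n]]]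
    have "dist (d (I x (Suc n))) (d (I x n)) \<le> 2 * (1/2)^n" unfolding I_Suc by blast
    ultimately show ?thesis by blast
  qed
  \<comment> \<open>Outside \<open>?D\<close> the least indices carry no information. The constant
    value there keeps the sequence Cauchy at every \<open>x\<close>.\<close>
  define f where "f n x = (if x \<in> ?D then d (I x n) else d 0)" for n x
  \<comment> \<open>The right-hand side is the geometric sum of the steps 2 (1/2)^i for i from m to
    m+k-1.\<close>
  have f_dist: "dist (f m x) (f (m + k) x) \<le> 4 * (1/2)^m - 4 * (1/2)^(m+k)" for m k x
  proof (induction k)
    case (Suc k)
    have "dist (f (m + k) x) (f (m + Suc k) x) \<le> 2 * (1/2)^(m+k)"
      using IR[of x "m + k"] by (simp add: f_def dist_commute)
    moreover have "dist (f m x) (f (m + Suc k) x) \<le> dist (f m x) (f (m + k) x) + dist (f (m + k) x) (f (m + Suc k) x)"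
      by (rule dist_triangle)
    ultimately show ?case using Suc by (simp only: add_Suc_right power_Suc)
  qed simp
  have f_Cauchy: "Cauchy (\<lambda>n. f n x)" for x
  proof (rule CauchyI')
    fix e :: real assume "e > 0"
    then obtain N where N: "(1/2)^N < e / 4"
      using real_arch_pow_inv[of "e/4" "1/2"] by auto
    have "dist (f m x) (f n x) < e" if "m \<ge> N" "n > m" for m n
    proof -
      define k where "k = n - m"
      then have k: "n = m + k" using that by simp
      have "(1/2::real)^m \<le> (1/2)^N" using that by (intro power_decreasing) auto
      with f_dist[of m x k] N show ?thesis
        unfolding k using zero_le_power[of "1/2::real" "m+k"] by linarith
    qed
    then show "\<exists>M. \<forall>m\<ge>M. \<forall>n>m. dist (f m x) (f n x) < e" by blast
  qed
  define T where "T x = lim (\<lambda>n. f n x)" for x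
  have T: "(\<lambda>n. f n x) \<longlonglongrightarrow> T x" for x
    unfolding T_def convergent_LIMSEQ_iff[symmetric] by (rule Cauchy_convergent[OF f_Cauchy])
  have [measurable]: "?D \<in> sets borel" using D_closed by auto
  have f_meas: "f n \<in> borel_measurable borel" for n
    unfolding f_def by measurable
  have "T \<in> borel_measurable borel"
    by (rule borel_measurable_LIMSEQ_metric[OF f_meas T])
  moreover have "(x, T x) \<in> C" if x: "x \<in> ?D" for x
  proof -
    have "\<exists>v. (x, v) \<in> C \<and> dist (f n x) v \<le> (1/2)^n" for n
    proof -
      have "x \<in> R n (I x n)" using IR[OF x] by blast
      then obtain v where "(x, v) \<in> C" "dist (d (I x n)) v \<le> (1/2)^n"
        by (auto simp: R_def)
      with x show ?thesis by (auto simp only: f_def if_True)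
    qed
    then obtain v where v: "\<And>n. (x, v n) \<in> C" "\<And>n. dist (f n x) (v n) \<le> (1/2)^n" by metis
    have "(\<lambda>n. dist (f n x) (v n)) \<longlonglongrightarrow> 0"
      by (rule tendsto_sandwich[OF _ _ tendsto_const LIMSEQ_realpow_zero[of "1/2"]])
        (use v(2) in \<open>simp_all add: always_eventually\<close>)
    from tendsto_add[OF this T[THEN tendsto_dist_iff[THEN iffD1], of x]]
    have "(\<lambda>n. dist (f n x) (v n) + dist (f n x) (T x)) \<longlonglongrightarrow> 0" by simp
    then have "(\<lambda>n. dist (v n) (T x)) \<longlonglongrightarrow> 0"
      by (rule tendsto_sandwich[OF _ _ tendsto_const, rotated 2]) (simp_all add: dist_triangle3)
    then have "v \<longlonglongrightarrow> T x" by (rule tendsto_dist_iff[THEN iffD2])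
    then have "(\<lambda>n. (x, v n)) \<longlonglongrightarrow> (x, T x)" by (intro tendsto_intros)
    then show ?thesis using C v(1) by (meson closed_sequentially)
  qed
  ultimately show thesis using that by blast
qed

text \<open>Since \<open>B\<close> is the projection of a closed set, so is its own projection, now
  along a larger Polish factor. The closed sets \<open>D n\<close> fill it up to measure (1/2)^n,
  hence it differs from their union by a null set. On that union the selectors of the pieces are
  glued by the least index.\<close>

theorem measurable_projection_selection:
  fixes B :: "('x::{metric_space, second_countable_topology} \<times> 'y::polish_space) set"
  assumes B: "B \<in> sets borel" and M: "finite_measure M" and sets_M: "sets M = sets borel"
  shows "fst ` B \<in> sets (completion M)"
    and "\<exists>T\<in>borel_measurable borel. AE x in M. x \<in> fst ` B \<longrightarrow> (x, T x) \<in> B"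
proof -
  interpret finite_measure M by fact
  have space_M: "space M = UNIV"
    using sets_eq_imp_space_eq[OF sets_M] by simp
  obtain C0 :: "(('x \<times> 'y) \<times> (nat \<Rightarrow> real)) set" where C0: "closed C0" "B = fst ` C0"
    using analytic_borel[OF B] unfolding analytic_def by blast
  \<comment> \<open>Reassociates the triple, so that \<open>y\<close> and the auxiliary sequence
    together form the factor that is projected away.\<close>
  define C where "C = (\<lambda>p. ((fst p, fst (snd p)), snd (snd p))) -` C0"
  have C: "closed C"
    unfolding C_def by (intro closed_vimage C0 continuous_intros)
  have CB: "(x, y) \<in> B \<longleftrightarrow> (\<exists>z. (x, y, z) \<in> C)" for x y
    by (auto simp: C0 C_def image_iff Bex_def)
  have C_fst: "fst ` B = fst ` C"
    by (auto simp: set_eq_iff image_iff Bex_def CB)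
  have "\<exists>K. compact K \<and> outer_measure_of M (fst ` B) \<le> emeasure M (fst ` (C \<inter> UNIV \<times> K)) + ennreal ((1/2)^n)" for n
    using capacity_compact[OF C M sets_M, of "(1/2)^n"] unfolding C_fst by (metis zero_less_power half_gt_zero zero_less_one)
  then obtain K where K: "\<And>n. compact (K n)"
    and K_lower: "\<And>n. outer_measure_of M (fst ` B) \<le> emeasure M (fst ` (C \<inter> UNIV \<times> K n)) + ennreal ((1/2)^n)"
    by metis
  define D where "D n = fst ` (C \<inter> UNIV \<times> K n)" for n
  have D_sets: "D n \<in> sets borel" for n
    unfolding D_def using closed_proj_compact[OF C K] by auto
  have D_sub: "(\<Union>n. D n) \<subseteq> fst ` B"
    unfolding C_fst D_def by auto
  \<comment> \<open>A measurable hull of the projection. It is squeezed against the union of the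
    \<open>D n\<close> from outside.\<close>
  obtain E where E: "E \<in> sets M" "fst ` B \<subseteq> E" "outer_measure_of M (fst ` B) = emeasure M E"
    using outer_measure_of_attain[of "fst ` B" M] by (auto simp: space_M)
  have UD: "(\<Union>n. D n) \<in> sets M" using D_sets by (auto simp: sets_M)
  have le: "emeasure M E \<le> emeasure M (\<Union>n. D n)"
  proof (rule ennreal_le_epsilon)
    fix e :: real assume "e > 0"
    then obtain n where n: "(1/2)^n < e"
      using real_arch_pow_inv[of e "1/2"] by auto
    have "emeasure M E \<le> emeasure M (D n) + ennreal ((1/2)^n)"
      using K_lower[of n] E(3) by (simp add: D_def)
    also have "\<dots> \<le> emeasure M (\<Union>n. D n) + ennreal e"
      using n UD by (intro add_mono emeasure_mono ennreal_leI) auto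
    finally show "emeasure M E \<le> emeasure M (\<Union>n. D n) + ennreal e" .
  qed
  have "emeasure M (E - (\<Union>n. D n)) = emeasure M E - emeasure M (\<Union>n. D n)"
    using E D_sub UD by (intro emeasure_Diff) (auto simp: emeasure_finite)
  also have "\<dots> = 0" using le by (simp add: diff_eq_0_iff_ennreal less_top[symmetric])
  finally have null: "E - (\<Union>n. D n) \<in> null_sets M"
    using E UD by (intro null_setsI) auto
  show "fst ` B \<in> sets (completion M)"
    by (rule sets_completionI[of _ "\<Union>n. D n" "fst ` B - (\<Union>n. D n)" "E - (\<Union>n. D n)"])
      (use D_sub E UD null in auto)
  have "\<exists>T. T \<in> borel_measurable borel \<and> (\<forall>x\<in>D n. (x, T x) \<in> C)" for n
    using compact_selection[OF C K[of n]] unfolding D_def by metis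
  then obtain T where T_meas[measurable]: "\<And>n. T n \<in> borel_measurable borel"
    and T: "\<And>n x. x \<in> D n \<Longrightarrow> (x, T n x) \<in> C" by metis
  note [measurable] = D_sets
  define N where "N x = (LEAST n. x \<in> D n)" for x
  have N_meas[measurable]: "N \<in> borel \<rightarrow>\<^sub>M count_space UNIV"
    unfolding N_def by measurable
  have "(\<lambda>x. T (N x) x) \<in> borel_measurable borel"
    by (rule measurable_compose_countable[OF T_meas N_meas])
  \<comment> \<open>The selector of \<open>C\<close> yields \<open>y\<close> together with an
    auxiliary sequence; only \<open>y\<close> is kept.\<close>
  then have "(\<lambda>x. fst (T (N x) x)) \<in> borel_measurable borel"
    by (rule measurable_compose) (auto intro!: borel_measurable_continuous_onI continuous_intros)
  moreover have "AE x in M. x \<in> fst ` B \<longrightarrow> (x, fst (T (N x) x)) \<in> B"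
    using AE_not_in[OF null]
  proof eventually_elim
    case (elim x)
    show ?case
    proof
      assume "x \<in> fst ` B"
      with elim E obtain n where "x \<in> D n" by auto
      then have "x \<in> D (N x)" unfolding N_def by (rule LeastI)
      from T[OF this] show "(x, fst (T (N x) x)) \<in> B"
        using CB by (metis prod.collapse)
    qed
  qed
  ultimately show "\<exists>T\<in>borel_measurable borel. AE x in M. x \<in> fst ` B \<longrightarrow> (x, T x) \<in> B"
    by (intro bexI[of _ "\<lambda>x. fst (T (N x) x)"])
qed

subsection \<open>Mixtures and extended expectations\<close>

lemma sets_mixture [simp]: "sets (mixture t Q1 Q2) = sets borel"
  by (simp add: mixture_def sets.sigma_sets_eq[of borel, simplified])

lemma space_mixture [simp]: "space (mixture t Q1 Q2) = UNIV"
  by (simp add: mixture_def)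

lemma emeasure_mixture:
  assumes "sets Q1 = sets borel" "sets Q2 = sets borel" and A: "A \<in> sets borel"
  shows "emeasure (mixture t Q1 Q2) A = ennreal t * emeasure Q1 A + ennreal (1 - t) * emeasure Q2 A"
proof (rule emeasure_measure_of[OF mixture_def])
  show "countably_additive (sets (mixture t Q1 Q2))
      (\<lambda>A. ennreal t * emeasure Q1 A + ennreal (1 - t) * emeasure Q2 A)"
    unfolding countably_additive_def
  proof (intro allI impI)
    fix A :: "nat \<Rightarrow> 'a set"
    assume A: "range A \<subseteq> sets (mixture t Q1 Q2)" "disjoint_family A"
    have "(\<Sum>i. emeasure Q1 (A i)) = emeasure Q1 (\<Union>(range A))"
      "(\<Sum>i. emeasure Q2 (A i)) = emeasure Q2 (\<Union>(range A))"
      using A assms by (auto intro!: suminf_emeasure)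
    then show "(\<Sum>i. ennreal t * emeasure Q1 (A i) + ennreal (1 - t) * emeasure Q2 (A i)) =
        ennreal t * emeasure Q1 (\<Union>(range A)) + ennreal (1 - t) * emeasure Q2 (\<Union>(range A))"
      by (simp add: suminf_add[symmetric] ennreal_suminf_cmult)
  qed
qed (use A in \<open>auto simp: positive_def\<close>)

lemma nn_integral_mixture:
  assumes sets: "sets Q1 = sets borel" "sets Q2 = sets borel" and f: "f \<in> borel_measurable borel"
  shows "(\<integral>\<^sup>+ x. f x \<partial>mixture t Q1 Q2) =
    ennreal t * (\<integral>\<^sup>+ x. f x \<partial>Q1) + ennreal (1 - t) * (\<integral>\<^sup>+ x. f x \<partial>Q2)"
  using f
proof (induction rule: borel_measurable_induct)
  case (cong f g)
  then show ?case by (simp cong: nn_integral_cong)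
next
  case (set A)
  then show ?case using sets by (simp add: emeasure_mixture)
next
  case (mult u c)
  then have "u \<in> borel_measurable Q1" "u \<in> borel_measurable Q2" "u \<in> borel_measurable (mixture t Q1 Q2)"
    using sets by (simp_all cong: measurable_cong_sets)
  with mult show ?case by (simp add: nn_integral_cmult distrib_left ac_simps)
next
  case (add u v)
  then have "u \<in> borel_measurable Q1" "u \<in> borel_measurable Q2" "u \<in> borel_measurable (mixture t Q1 Q2)"
    "v \<in> borel_measurable Q1" "v \<in> borel_measurable Q2" "v \<in> borel_measurable (mixture t Q1 Q2)"
    using sets by (simp_all cong: measurable_cong_sets)
  with add show ?case by (simp add: nn_integral_add distrib_left ac_simps)
next
  case (seq U)
  then have U: "U i \<in> borel_measurable Q1" "U i \<in> borel_measurable Q2" "U i \<in> borel_measurable (mixture t Q1 Q2)" for i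
    using sets by (simp_all cong: measurable_cong_sets)
  have inc: "incseq (\<lambda>i. ennreal s * integral\<^sup>N Q (U i))" for s Q
    using seq by (intro incseq_SucI mult_left_mono nn_integral_mono) (auto simp: incseq_Suc_iff le_fun_def)
  have eq: "integral\<^sup>N Q (Sup (range U)) = (SUP i. integral\<^sup>N Q (U i))" if "\<And>i. U i \<in> borel_measurable Q" for Q
    
  proof -
    have "Sup (range U) = (\<lambda>x. SUP i. U i x)" by (rule ext) (simp add: image_comp)
    then show ?thesis using nn_integral_monotone_convergence_SUP[OF \<open>incseq U\<close> that] by simp
  qed
  show ?case
    unfolding eq[OF U(1)] eq[OF U(2)] eq[OF U(3)]
    using seq inc by (simp add: SUP_mult_left_ennreal ennreal_SUP_add[symmetric])
qed

lemma prob_space_mixture: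
  assumes "prob_space Q1" "prob_space Q2" "sets Q1 = sets borel" "sets Q2 = sets borel" "0 \<le> t" "t \<le> 1"
  shows "prob_space (mixture t Q1 Q2)"
proof
  have "space Q1 = UNIV" "space Q2 = UNIV"
    using assms(3,4)[THEN sets_eq_imp_space_eq] by auto
  then show "emeasure (mixture t Q1 Q2) (space (mixture t Q1 Q2)) = 1"
    using assms prob_space.emeasure_space_1[of Q1] prob_space.emeasure_space_1[of Q2]
    by (simp add: emeasure_mixture ennreal_plus[symmetric] del: ennreal_plus)
qed

lemma distr_mixture:
  assumes "sets Q1 = sets borel" "sets Q2 = sets borel" and f: "f \<in> borel_measurable borel"
  shows "distr (mixture t Q1 Q2) borel f = mixture t (distr Q1 borel f) (distr Q2 borel f)"
proof (rule measure_eqI)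
  fix A assume "A \<in> sets (distr (mixture t Q1 Q2) borel f)"
  then have A: "A \<in> sets borel" by simp
  have sp: "space Q1 = UNIV" "space Q2 = UNIV"
    using assms(1,2)[THEN sets_eq_imp_space_eq] by auto
  have m: "f \<in> measurable (mixture t Q1 Q2) borel" "f \<in> measurable Q1 borel" "f \<in> measurable Q2 borel"
    using f assms by (simp_all cong: measurable_cong_sets)
  have "f -` A \<in> sets borel"
    using measurable_sets[OF f A] by simp
  with A m assms show "emeasure (distr (mixture t Q1 Q2) borel f) A =
      emeasure (mixture t (distr Q1 borel f) (distr Q2 borel f)) A"
    by (simp add: emeasure_distr emeasure_mixture sp)
qed simp

text \<open>Holds for arbitrary \<open>f\<close>, because the nonnegative integral is a supremum
  over simple functions below the integrand and the completion alters those only on null sets. It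
  reduces the expectations of the theorem to plain ones.\<close>

lemma expect_completion: "expect (completion M) f = expect M f"
  by (simp add: expect_def nn_integral_completion)

lemma expect_mono_AE:
  assumes "AE x in M. f x \<le> g x"
  shows "expect M f \<le> expect M g"
  unfolding expect_def using assms
  by (intro ereal_minus_mono) (auto simp flip: less_eq_ennreal.rep_eq intro!: nn_integral_mono_AE elim!: eventually_mono intro: e2ennreal_mono)

lemma expect_cong_AE:
  assumes "AE x in M. f x = g x"
  shows "expect M f = expect M g"
  using assms by (intro antisym expect_mono_AE) (auto elim!: eventually_mono)

lemma expect_distr:
  assumes "T \<in> measurable M N" "f \<in> borel_measurable N"
  shows "expect (distr M N T) f = expect M (\<lambda>x. f (T x))"
  unfolding expect_def using assms by (simp add: nn_integral_distr)

lemma e2ennreal_divide: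
  assumes "b > 0"
  shows "e2ennreal (x / ereal b) = ennreal (1 / b) * e2ennreal x"
  using assms by (cases x) (auto simp: ennreal_mult'[symmetric] e2ennreal_neg ennreal_mult_top)

lemma e2ennreal_uminus_divide:
  assumes "b > 0"
  shows "e2ennreal (- (x / ereal b)) = ennreal (1 / b) * e2ennreal (- x)"
proof -
  have "- (x / ereal b) = - x / ereal b"
    using assms by simp
  then show ?thesis
    by (simp only: e2ennreal_divide[OF assms])
qed

lemma expect_divide:
  assumes b: "b > 0" and f: "f \<in> borel_measurable M"
  shows "expect M (\<lambda>x. f x / ereal b) = expect M f / ereal b"
proof -
  have "expect M (\<lambda>x. f x / ereal b) =
      enn2ereal (ennreal (1 / b) * (\<integral>\<^sup>+ x. e2ennreal (f x) \<partial>M)) -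
      enn2ereal (ennreal (1 / b) * (\<integral>\<^sup>+ x. e2ennreal (- f x) \<partial>M))"
    unfolding expect_def using b f
    by (simp add: e2ennreal_divide e2ennreal_uminus_divide nn_integral_cmult del: ereal_uminus_divide)
  also have "\<dots> = expect M f / ereal b"
    unfolding expect_def using b
    by (cases "\<integral>\<^sup>+ x. e2ennreal (f x) \<partial>M" rule: ennreal_cases;
        cases "\<integral>\<^sup>+ x. e2ennreal (- f x) \<partial>M" rule: ennreal_cases)
      (auto simp: ennreal_mult'[symmetric] ennreal_mult_top diff_divide_distrib)
  finally show ?thesis .
qed

text \<open>The decomposition of u - w into positive and negative parts, rearranged into sums of
  nonnegative terms. It can therefore be integrated without meeting a difference of
  infinities.\<close>

lemma ereal_parts_diff:
  assumes "w < top"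
  shows "e2ennreal (u - enn2ereal w) + (e2ennreal (- u) + w) = e2ennreal (- (u - enn2ereal w)) + e2ennreal u"
proof (cases w rule: ennreal_cases)
  case (real r)
  show ?thesis
  proof (cases u)
    case (real s)
    show ?thesis
      unfolding \<open>u = _\<close> \<open>w = _\<close> using \<open>0 \<le> r\<close>
      by (cases "s \<ge> 0"; cases "s \<ge> r")
        (auto simp: ennreal_neg ennreal_plus[symmetric] simp del: ennreal_plus)
  qed (use real in auto)
qed (use assms in auto)

lemma expect_diff:
  assumes u: "u \<in> borel_measurable M" and w: "w \<in> borel_measurable M"
    and fin: "(\<integral>\<^sup>+ x. w x \<partial>M) < \<infinity>"
    and semi: "(\<integral>\<^sup>+ x. e2ennreal (u x) \<partial>M) < \<infinity> \<or> (\<integral>\<^sup>+ x. e2ennreal (- u x) \<partial>M) < \<infinity>"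
  shows "expect M (\<lambda>x. u x - enn2ereal (w x)) = expect M u - enn2ereal (\<integral>\<^sup>+ x. w x \<partial>M)"
proof -
  note [measurable] = u w
  let ?A = "\<integral>\<^sup>+ x. e2ennreal (u x - enn2ereal (w x)) \<partial>M"
  let ?B = "\<integral>\<^sup>+ x. e2ennreal (- (u x - enn2ereal (w x))) \<partial>M"
  let ?U = "\<integral>\<^sup>+ x. e2ennreal (u x) \<partial>M"
  let ?V = "\<integral>\<^sup>+ x. e2ennreal (- u x) \<partial>M"
  let ?W = "\<integral>\<^sup>+ x. w x \<partial>M"
  have "?A + (?V + ?W) = (\<integral>\<^sup>+ x. e2ennreal (u x - enn2ereal (w x)) + (e2ennreal (- u x) + w x) \<partial>M)"
    by (simp add: nn_integral_add)
  also have "\<dots> = (\<integral>\<^sup>+ x. e2ennreal (- (u x - enn2ereal (w x))) + e2ennreal (u x) \<partial>M)"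
  proof (rule nn_integral_cong_AE)
    have "AE x in M. w x \<noteq> \<infinity>"
      using w fin by (intro nn_integral_PInf_AE) auto
    then show "AE x in M. e2ennreal (u x - enn2ereal (w x)) + (e2ennreal (- u x) + w x) =
        e2ennreal (- (u x - enn2ereal (w x))) + e2ennreal (u x)"
      by eventually_elim (simp add: ereal_parts_diff less_top)
  qed
  also have "\<dots> = ?B + ?U"
    by (simp add: nn_integral_add)
  finally have eq: "?A + (?V + ?W) = ?B + ?U" .
  \<comment> \<open>If \<open>?U\<close> is finite, this makes \<open>?A\<close> finite as well, so
    that \<open>eq\<close> determines the difference of \<open>?A\<close> and
    \<open>?B\<close>.\<close>
  have AU: "?A \<le> ?U"
    by (intro nn_integral_mono e2ennreal_mono) (simp add: ereal_diff_le_self)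
  have [simp]: "expect M (\<lambda>x. u x - enn2ereal (w x)) = enn2ereal ?A - enn2ereal ?B"
    "expect M u = enn2ereal ?U - enn2ereal ?V"
    by (simp_all add: expect_def)
  obtain W where W: "?W = ennreal W" "W \<ge> 0"
    using fin by (cases ?W rule: ennreal_cases) auto
  show ?thesis
    using eq AU semi unfolding W
    apply (simp only: \<open>expect M (\<lambda>x. u x - enn2ereal (w x)) = _\<close> \<open>expect M u = _\<close>)
    using W(2)
    by (cases ?A rule: ennreal_cases; cases ?B rule: ennreal_cases;
        cases ?U rule: ennreal_cases; cases ?V rule: ennreal_cases)
      (auto simp: ennreal_plus[symmetric] top_unique simp del: ennreal_plus)
qed

text \<open>Demanding finiteness of the same part under both measures excludes infinite expectations
  of opposite sign.\<close>

lemma expect_mixture: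
  assumes sets: "sets Q1 = sets borel" "sets Q2 = sets borel" and f: "f \<in> borel_measurable borel"
    and t: "0 \<le> t" "t \<le> 1"
    and semi: "(\<forall>Q\<in>{Q1, Q2}. (\<integral>\<^sup>+ x. e2ennreal (f x) \<partial>Q) < \<infinity>) \<or>
      (\<forall>Q\<in>{Q1, Q2}. (\<integral>\<^sup>+ x. e2ennreal (- f x) \<partial>Q) < \<infinity>)"
  shows "expect (mixture t Q1 Q2) f = ereal t * expect Q1 f + ereal (1 - t) * expect Q2 f"
proof -
  have [measurable]: "(\<lambda>x. e2ennreal (f x)) \<in> borel_measurable borel"
    "(\<lambda>x. e2ennreal (- f x)) \<in> borel_measurable borel"
    using f by measurable
  let ?U = "\<lambda>Q. \<integral>\<^sup>+ x. e2ennreal (f x) \<partial>Q" and ?V = "\<lambda>Q. \<integral>\<^sup>+ x. e2ennreal (- f x) \<partial>Q"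
  \<comment> \<open>At the endpoints a possibly infinite integral is multiplied by zero, so they are
    treated apart.\<close>
  consider "t = 0" | "t = 1" | "0 < t" "t < 1" using t by linarith
  then show ?thesis
  proof cases
    case 3
    define s where "s = 1 - t"
    have "0 < s" using 3 by (simp add: s_def)
    show ?thesis
      unfolding expect_def s_def[symmetric]
      apply (simp add: nn_integral_mixture sets flip: s_def)
      using 3 \<open>0 < s\<close> semi
      by (cases "?U Q1" rule: ennreal_cases; cases "?U Q2" rule: ennreal_cases;
          cases "?V Q1" rule: ennreal_cases; cases "?V Q2" rule: ennreal_cases)
        (auto simp: ennreal_mult'[symmetric] ennreal_plus[symmetric] ennreal_mult_top algebra_simps simp del: ennreal_plus)
  qed (auto simp: expect_def nn_integral_mixture sets simp flip: zero_ereal_def)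
qed

lemma expect_ereal:
  assumes "integrable M h"
  shows "expect M (\<lambda>x. ereal (h x)) = ereal (LINT x|M. h x)"
proof -
  obtain r q where "0 \<le> r" "0 \<le> q" "(\<integral>\<^sup>+x. ennreal (h x) \<partial>M) = ennreal r"
    "(\<integral>\<^sup>+x. ennreal (- h x) \<partial>M) = ennreal q" "(LINT x|M. h x) = r - q"
    using integrableE[OF assms] by metis
  then show ?thesis by (simp add: expect_def)
qed

subsection \<open>The regularized loss and couplings\<close>

lemma measurable_fst_snd_borel [measurable]:
  "fst \<in> (borel :: ('a::topological_space \<times> 'b::topological_space) measure) \<rightarrow>\<^sub>M borel"
  "snd \<in> (borel :: ('a::topological_space \<times> 'b::topological_space) measure) \<rightarrow>\<^sub>M borel"
  by (auto intro!: borel_measurable_continuous_onI continuous_intros)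

lemma borel_measurable_cost_function:
  assumes "cost_function c"
  shows "(\<lambda>p. c (fst p) (snd p)) \<in> borel_measurable borel"
  using assms by (intro borel_measurableI_le) (auto simp: cost_function_def)

lemma borel_measurable_OT_integrand:
  assumes L: "L \<in> borel_measurable borel" and c: "cost_function c"
  shows "(\<lambda>p. L (snd p) / ereal b - enn2ereal (c (fst p) (snd p))) \<in> borel_measurable borel"
proof -
  note [measurable] = L borel_measurable_cost_function[OF c]
  show ?thesis by measurable
qed

text \<open>Positive and negative parts are replaced separately by Borel versions. This supplies a
  Borel stand-in for the regularized loss, which is itself measurable only for the
  completion.\<close>

lemma completion_ex_borel_measurable_ereal:
  fixes F :: "'a \<Rightarrow> ereal"
  assumes F: "F \<in> borel_measurable (completion M)"
  shows "\<exists>G\<in>borel_measurable M. AE x in M. F x = G x"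
proof -
  have "(\<lambda>x. e2ennreal (F x)) \<in> borel_measurable (completion M)"
    "(\<lambda>x. e2ennreal (- F x)) \<in> borel_measurable (completion M)"
    using F by measurable
  from this[THEN completion_ex_borel_measurable] obtain p n :: "'a \<Rightarrow> ennreal"
    where [measurable]: "p \<in> borel_measurable M" "n \<in> borel_measurable M"
      and ae: "AE x in M. e2ennreal (F x) = p x" "AE x in M. e2ennreal (- F x) = n x"
    by auto
  have split: "y = enn2ereal (e2ennreal y) - enn2ereal (e2ennreal (- y))" for y :: ereal
    by (cases "y \<ge> 0") (auto simp: enn2ereal_e2ennreal e2ennreal_neg zero_ennreal.rep_eq)
  have "AE x in M. F x = enn2ereal (p x) - enn2ereal (n x)"
    using ae by eventually_elim (metis split)
  then show ?thesis
    by (intro bexI[of _ "\<lambda>x. enn2ereal (p x) - enn2ereal (n x)"]) measurable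
qed

text \<open>A supremum over uncountably many \<open>y\<close> exceeds \<open>t\<close> exactly on
  the projection of the Borel set of pairs at which the integrand does.\<close>

lemma borel_measurable_completion_OT_reg_loss:
  fixes M :: "'a::polish_space measure"
  assumes "finite_measure M" "sets M = sets borel" and L: "L \<in> borel_measurable borel" and c: "cost_function c"
  shows "OT_reg_loss L c b \<in> borel_measurable (completion M)"
proof (rule borel_measurableI_greater)
  fix t
  let ?B = "{p. t < L (snd p) / ereal b - enn2ereal (c (fst p) (snd p))}"
  note [measurable] = borel_measurable_OT_integrand[OF L c]
  have "?B \<in> sets borel" by measurable
  from measurable_projection_selection(1)[OF this assms(1,2)]
  have "fst ` ?B \<in> sets (completion M)" .
  also have "fst ` ?B = {x \<in> space (completion M). t < OT_reg_loss L c b x}"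
    using sets_eq_imp_space_eq[OF assms(2)]
    by (auto simp: OT_reg_loss_def less_SUP_iff image_iff Bex_def)
  finally show "{x \<in> space (completion M). t < OT_reg_loss L c b x} \<in> sets (completion M)" .
qed

section \<open>Integrable minorants and almost optimal couplings\<close>

lemma nn_integral_lt_top_bounded:
  assumes "prob_space M" and "\<And>x. f x \<le> ereal b"
  shows "(\<integral>\<^sup>+ x. e2ennreal (f x) \<partial>M) < \<infinity>"
proof -
  have "(\<integral>\<^sup>+ x. e2ennreal (f x) \<partial>M) \<le> (\<integral>\<^sup>+ x. ennreal b \<partial>M)"
    using assms(2) by (intro nn_integral_mono) (metis e2ennreal_ereal e2ennreal_mono)
  also have "\<dots> < \<infinity>"
    using assms(1) by (simp add: prob_space.emeasure_space_1 ennreal_mult_less_top less_top)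
  finally show ?thesis .
qed

text \<open>Truncating the positive part at a large \<open>N\<close> gives an integrable function
  with expectation still above \<open>r\<close>, and subtracting the constant \<open>d\<close> makes
  the bound strict. Strictness lets a single \<open>y\<close> beat \<open>h x\<close> in the
  supremum defining \<open>OT_reg_loss\<close>.\<close>

lemma ex_integrable_minorant:
  assumes M: "prob_space M" and G: "G \<in> borel_measurable M"
    and semi: "(\<integral>\<^sup>+ x. e2ennreal (G x) \<partial>M) < \<infinity> \<or> (\<integral>\<^sup>+ x. e2ennreal (- G x) \<partial>M) < \<infinity>"
    and r: "ereal r < expect M G"
  shows "\<exists>h. integrable M h \<and> (AE x in M. ereal (h x) < G x) \<and> r < (LINT x|M. h x)"
proof -
  interpret prob_space M by fact
  note [measurable] = G
  let ?V = "\<integral>\<^sup>+ x. e2ennreal (- G x) \<partial>M"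
  let ?U = "\<integral>\<^sup>+ x. e2ennreal (G x) \<partial>M"
  \<comment> \<open>Otherwise \<open>semi\<close> would make the positive part finite and the
    expectation minus infinity, with no real \<open>r\<close> below it.\<close>
  have "?V < \<infinity>"
  proof (rule ccontr)
    assume "\<not> ?V < \<infinity>"
    then have "?V = top" by (simp add: less_top[symmetric])
    moreover from this semi have "?U < \<infinity>" by auto
    ultimately show False using r by (cases ?U rule: ennreal_cases) (auto simp: expect_def)
  qed
  then obtain V where V: "?V = ennreal V" "V \<ge> 0"
    by (cases ?V rule: ennreal_cases) auto
  have "ereal (r + V) < enn2ereal ?U"
    using r V by (cases ?U rule: ennreal_cases) (auto simp: expect_def)
  let ?m = "\<lambda>N x. min (e2ennreal (G x)) (of_nat N)"
  have sup: "(SUP N. ?m N x) = e2ennreal (G x)" for x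
  proof -
    have "(SUP N. ?m N x) = min (e2ennreal (G x)) (SUP N. of_nat N)"
      unfolding inf_min[symmetric] by (rule inf_SUP[symmetric])
    then show ?thesis by (simp add: ennreal_SUP_of_nat_eq_top)
  qed
  have "incseq ?m"
    by (intro incseq_SucI le_funI min.mono order_refl of_nat_mono) auto
  then have "?U = (SUP N. \<integral>\<^sup>+ x. ?m N x \<partial>M)"
    by (subst nn_integral_monotone_convergence_SUP[symmetric]) (auto simp: sup)
  have "\<exists>N. ereal (r + V) < enn2ereal (\<integral>\<^sup>+ x. ?m N x \<partial>M)"
  proof (cases "r + V < 0")
    case True
    then show ?thesis
      by (intro exI[of _ 0]) (rule less_le_trans[OF _ enn2ereal_nonneg], simp)
  next
    case False
    then have "ennreal (r + V) < ?U"
      using \<open>ereal (r + V) < _\<close> by (simp add: less_ennreal.rep_eq)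
    then obtain N where "ennreal (r + V) < (\<integral>\<^sup>+ x. ?m N x \<partial>M)"
      unfolding \<open>?U = _\<close> less_SUP_iff by auto
    then show ?thesis using False by (auto simp: less_ennreal.rep_eq)
  qed
  then obtain N where N: "ereal (r + V) < enn2ereal (\<integral>\<^sup>+ x. ?m N x \<partial>M)" by blast
  have mN: "(\<integral>\<^sup>+ x. ?m N x \<partial>M) < \<infinity>"
  proof -
    have "(\<integral>\<^sup>+ x. ?m N x \<partial>M) \<le> (\<integral>\<^sup>+ x. of_nat N \<partial>M)" by (intro nn_integral_mono) auto
    also have "\<dots> < \<infinity>" by (simp add: emeasure_space_1 less_top[symmetric])
    finally show ?thesis .
  qed
  define p where "p x = enn2real (?m N x)" for x
  define n where "n x = enn2real (e2ennreal (- G x))" for x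
  have [measurable]: "p \<in> borel_measurable M" "n \<in> borel_measurable M"
    unfolding p_def n_def by measurable
  have p: "ennreal (p x) = ?m N x" for x
    unfolding p_def
    by (rule ennreal_enn2real, rule le_less_trans[OF min.cobounded2]) (simp add: less_top[symmetric])
  have ae: "AE x in M. e2ennreal (- G x) \<noteq> \<infinity>"
    using \<open>?V < \<infinity>\<close> by (intro nn_integral_PInf_AE) auto
  then have n: "AE x in M. ennreal (n x) = e2ennreal (- G x)"
    by eventually_elim (simp add: n_def less_top)
  have nV: "(\<integral>\<^sup>+ x. ennreal (n x) \<partial>M) = ?V"
    by (rule nn_integral_cong_AE[OF n])
  have int: "integrable M p" "integrable M n"
    using mN \<open>?V < \<infinity>\<close> nV by (auto intro!: integrableI_nonneg simp: p) (auto simp: p_def n_def)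
  have "(LINT x|M. p x) = enn2real (\<integral>\<^sup>+ x. ?m N x \<partial>M)" "(LINT x|M. n x) = V"
    using nV V by (subst integral_eq_nn_integral; simp add: p; simp add: p_def n_def)+
  moreover have "r + V < enn2real (\<integral>\<^sup>+ x. ?m N x \<partial>M)"
    using N mN by (cases "\<integral>\<^sup>+ x. ?m N x \<partial>M" rule: ennreal_cases) auto
  ultimately have gt: "r < (LINT x|M. p x - n x)"
    using int by simp
  \<comment> \<open>Half of the surplus over \<open>r\<close>, so that the integral stays above
    \<open>r\<close> after the subtraction.\<close>
  define d where "d = ((LINT x|M. p x - n x) - r) / 2"
  have d: "d > 0" using gt by (simp add: d_def)
  show ?thesis
  proof (intro exI conjI)
    show "integrable M (\<lambda>x. p x - n x - d)" using int by simp
    have "(LINT x|M. p x - n x - d) = (LINT x|M. p x - n x) - d"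
      using int by (simp add: prob_space)
    then show "r < (LINT x|M. p x - n x - d)"
      using gt by (simp add: d_def field_simps)
    show "AE x in M. ereal (p x - n x - d) < G x"
      using n ae
    proof eventually_elim
      case (elim x)
      show ?case
      proof (cases "G x")
        case (real g)
        then show ?thesis using elim p[of x] d
          by (cases "g \<ge> 0") (auto simp: ennreal_neg min_def p_def n_def split: if_splits)
      qed (use elim in auto)
    qed
  qed
qed

lemma expect_OT_integrand:
  fixes \<pi> :: "('a::topological_space \<times> 'a) measure"
  assumes sets: "sets \<pi> = sets borel"
    and L: "L \<in> borel_measurable borel" and c: "cost_function c" and b: "b > 0"
    and fin: "(\<integral>\<^sup>+ p. c (fst p) (snd p) \<partial>\<pi>) < \<infinity>"
    and semi: "(\<integral>\<^sup>+ x. e2ennreal (L x) \<partial>distr \<pi> borel snd) < \<infinity> \<or>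
      (\<integral>\<^sup>+ x. e2ennreal (- L x) \<partial>distr \<pi> borel snd) < \<infinity>"
  shows "expect \<pi> (\<lambda>p. L (snd p) / ereal b - enn2ereal (c (fst p) (snd p))) =
    expect (distr \<pi> borel snd) L / ereal b - enn2ereal (\<integral>\<^sup>+ p. c (fst p) (snd p) \<partial>\<pi>)"
proof -
  note [measurable_cong] = sets
  note [measurable] = L
  have [measurable]: "(\<lambda>p. c (fst p) (snd p)) \<in> borel_measurable \<pi>"
    using borel_measurable_cost_function[OF c] by measurable
  have Ls [measurable]: "(\<lambda>p. L (snd p)) \<in> borel_measurable \<pi>" by measurable
  have pos: "(\<integral>\<^sup>+ p. e2ennreal (L (snd p) / ereal b) \<partial>\<pi>) =
      ennreal (1 / b) * (\<integral>\<^sup>+ x. e2ennreal (L x) \<partial>distr \<pi> borel snd)"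
    using b by (simp add: e2ennreal_divide nn_integral_cmult nn_integral_distr)
  have neg: "(\<integral>\<^sup>+ p. e2ennreal (- (L (snd p) / ereal b)) \<partial>\<pi>) =
      ennreal (1 / b) * (\<integral>\<^sup>+ x. e2ennreal (- L x) \<partial>distr \<pi> borel snd)"
    unfolding e2ennreal_uminus_divide[OF b] using b
    by (simp add: nn_integral_cmult nn_integral_distr)
  have "expect \<pi> (\<lambda>p. L (snd p) / ereal b - enn2ereal (c (fst p) (snd p))) =
      expect \<pi> (\<lambda>p. L (snd p) / ereal b) - enn2ereal (\<integral>\<^sup>+ p. c (fst p) (snd p) \<partial>\<pi>)"
    using fin semi unfolding pos[symmetric]
    by (intro expect_diff) (auto simp: pos neg ennreal_mult_eq_top_iff less_top[symmetric])
  also have "expect \<pi> (\<lambda>p. L (snd p) / ereal b) = expect (distr \<pi> borel snd) L / ereal b"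
    using Ls b by (simp add: expect_divide expect_distr)
  finally show ?thesis .
qed

text \<open>The integrand at (x, y) is one of the competitors in the supremum at \<open>x\<close>.
  The Borel version \<open>G\<close> permits the change of variables along
  \<open>fst\<close>.\<close>

lemma expect_OT_le_expect_OT_reg_loss:
  fixes \<pi> :: "('a::polish_space \<times> 'a) measure"
  assumes \<pi>: "prob_space \<pi>" and sets: "sets \<pi> = sets borel"
    and L: "L \<in> borel_measurable borel" and c: "cost_function c" and b: "b > 0"
    and fin: "(\<integral>\<^sup>+ p. c (fst p) (snd p) \<partial>\<pi>) < \<infinity>"
    and semi: "(\<integral>\<^sup>+ x. e2ennreal (L x) \<partial>distr \<pi> borel snd) < \<infinity> \<or>
      (\<integral>\<^sup>+ x. e2ennreal (- L x) \<partial>distr \<pi> borel snd) < \<infinity>"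
  shows "expect (distr \<pi> borel snd) L / ereal b - enn2ereal (\<integral>\<^sup>+ p. c (fst p) (snd p) \<partial>\<pi>) \<le>
    expect (distr \<pi> borel fst) (OT_reg_loss L c b)"
proof -
  note [measurable_cong] = sets
  have fst_meas: "fst \<in> \<pi> \<rightarrow>\<^sub>M borel" by measurable
  let ?\<eta> = "distr \<pi> borel fst"
  have "finite_measure ?\<eta>"
    using \<pi> fst_meas by (intro prob_space.finite_measure prob_space.prob_space_distr)
  from completion_ex_borel_measurable_ereal[OF
      borel_measurable_completion_OT_reg_loss[OF this _ L c, of b]]
  obtain G where G: "G \<in> borel_measurable borel" and FG: "AE x in ?\<eta>. OT_reg_loss L c b x = G x"
    by auto
  have "expect \<pi> (\<lambda>p. L (snd p) / ereal b - enn2ereal (c (fst p) (snd p))) \<le> expect \<pi> (\<lambda>p. G (fst p))"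
  proof (rule expect_mono_AE)
    show "AE p in \<pi>. L (snd p) / ereal b - enn2ereal (c (fst p) (snd p)) \<le> G (fst p)"
      using AE_distrD[OF fst_meas FG]
    proof eventually_elim
      case (elim p)
      show ?case unfolding elim[symmetric] OT_reg_loss_def by (rule SUP_upper) simp
    qed
  qed
  also have "\<dots> = expect ?\<eta> G"
    using fst_meas G by (simp add: expect_distr)
  also have "\<dots> = expect ?\<eta> (OT_reg_loss L c b)"
    using FG by (intro expect_cong_AE) (auto elim!: eventually_mono)
  finally show ?thesis
    unfolding expect_OT_integrand[OF sets L c b fin semi] .
qed

text \<open>A measurable selection picks for each \<open>x\<close> a target whose value exceeds an
  integrable minorant \<open>h\<close> of the regularized loss. If \<open>L\<close> is bounded
  above, the gap to \<open>h\<close> also bounds the transport cost by an integrable function; if it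
  is bounded below, the transport is truncated.\<close>

lemma OT_reg_loss_approx_transport:
  fixes \<eta> :: "'a::polish_space measure"
  assumes \<eta>: "prob_space \<eta>" and sets: "sets \<eta> = sets borel"
    and L: "L \<in> borel_measurable borel" and L_not_inf: "\<And>x. L x \<noteq> \<infinity>"
    and L_cases: "(\<exists>l::real. \<forall>x. ereal l \<le> L x) \<or> (\<exists>l::real. \<forall>x. L x \<le> ereal l)"
    and c: "cost_function c" and c_diag: "\<And>x. c x x = 0" and b: "b > 0"
    and r: "ereal r < expect \<eta> (OT_reg_loss L c b)"
  shows "\<exists>S\<in>borel_measurable borel. (\<integral>\<^sup>+ x. c x (S x) \<partial>\<eta>) < \<infinity> \<and>
    ereal r < expect \<eta> (\<lambda>x. L (S x) / ereal b - enn2ereal (c x (S x)))"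
proof -
  interpret prob_space \<eta> by fact
  note [measurable_cong] = sets
  have space: "space \<eta> = UNIV" using sets_eq_imp_space_eq[OF sets] by simp
  let ?F = "OT_reg_loss L c b"
  obtain G where G: "G \<in> borel_measurable \<eta>" and FG: "AE x in \<eta>. ?F x = G x"
    using completion_ex_borel_measurable_ereal[OF
        borel_measurable_completion_OT_reg_loss[OF finite_measure_axioms sets L c, of b]] by auto
  have EFG: "expect \<eta> ?F = expect \<eta> G"
    using FG by (rule expect_cong_AE)
  have nnG: "(\<integral>\<^sup>+ x. e2ennreal (G x) \<partial>\<eta>) = (\<integral>\<^sup>+ x. e2ennreal (?F x) \<partial>\<eta>)"
    "(\<integral>\<^sup>+ x. e2ennreal (- G x) \<partial>\<eta>) = (\<integral>\<^sup>+ x. e2ennreal (- ?F x) \<partial>\<eta>)"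
    using FG by (auto intro!: nn_integral_cong_AE elim!: eventually_mono)
  \<comment> \<open>A lower bound on \<open>L\<close> passes to \<open>?F\<close> through the choice
    y = x of zero cost; an upper bound passes because the cost is nonnegative.\<close>
  have semi: "(\<integral>\<^sup>+ x. e2ennreal (G x) \<partial>\<eta>) < \<infinity> \<or> (\<integral>\<^sup>+ x. e2ennreal (- G x) \<partial>\<eta>) < \<infinity>"
    using L_cases
  proof
    assume "\<exists>l::real. \<forall>x. ereal l \<le> L x"
    then obtain l :: real where l: "\<And>x. ereal l \<le> L x" by blast
    have "- ?F x \<le> ereal (- (l / b))" for x
    proof -
      have "ereal (l / b) \<le> L x / ereal b"
        using ereal_divide_right_mono[OF l, of "ereal b"] b by simp
      also have "\<dots> = L x / ereal b - enn2ereal (c x x)" by (simp add: c_diag zero_ennreal.rep_eq)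
      also have "\<dots> \<le> ?F x" unfolding OT_reg_loss_def by (rule SUP_upper) simp
      finally show ?thesis by (metis ereal_minus_le_minus uminus_ereal.simps(1))
    qed
    from nn_integral_lt_top_bounded[where f = "\<lambda>x. - ?F x", OF \<eta> this] show ?thesis unfolding nnG by blast
  next
    assume "\<exists>l::real. \<forall>x. L x \<le> ereal l"
    then obtain l :: real where l: "\<And>x. L x \<le> ereal l" by blast
    have "?F x \<le> ereal (l / b)" for x
      unfolding OT_reg_loss_def
    proof (rule SUP_least)
      fix y
      have "L y / ereal b - enn2ereal (c x y) \<le> L y / ereal b"
        by (simp add: ereal_diff_le_self)
      also have "\<dots> \<le> ereal (l / b)"
        using ereal_divide_right_mono[OF l, of "ereal b"] b by simp
      finally show "L y / ereal b - enn2ereal (c x y) \<le> ereal (l / b)" .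
    qed
    from nn_integral_lt_top_bounded[where f = ?F, OF \<eta> this] show ?thesis unfolding nnG by blast
  qed
  obtain h where h: "integrable \<eta> h" and hG: "AE x in \<eta>. ereal (h x) < G x" and rh: "r < (LINT x|\<eta>. h x)"
    using ex_integrable_minorant[OF \<eta> G semi] r EFG by auto
  have h_meas [measurable]: "h \<in> borel_measurable borel"
    using borel_measurable_integrable[OF h] sets by (simp cong: measurable_cong_sets)
  note [measurable] = L borel_measurable_OT_integrand[OF L c] borel_measurable_cost_function[OF c]
  let ?B = "{p. ereal (h (fst p)) < L (snd p) / ereal b - enn2ereal (c (fst p) (snd p))}"
  have "?B \<in> sets borel" by measurable
  from measurable_projection_selection(2)[OF this finite_measure_axioms sets]
  obtain T where T [measurable]: "T \<in> borel_measurable borel" and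
    TB: "AE x in \<eta>. x \<in> fst ` ?B \<longrightarrow> (x, T x) \<in> ?B" by blast
  have hT: "AE x in \<eta>. ereal (h x) < L (T x) / ereal b - enn2ereal (c x (T x))"
    using TB FG hG
  proof eventually_elim
    case (elim x)
    then have "ereal (h x) < ?F x" by simp
    then obtain y where "(x, y) \<in> ?B"
      by (auto simp: OT_reg_loss_def less_SUP_iff)
    then have "x \<in> fst ` ?B" by (rule rev_image_eqI) simp
    with elim show ?case by simp
  qed
  have c_meas [measurable]: "(\<lambda>x. c x (S x)) \<in> borel_measurable borel"
    if [measurable]: "S \<in> borel_measurable borel" for S
  proof -
    have "(\<lambda>x. (x, S x)) \<in> borel \<rightarrow>\<^sub>M borel" by measurable
    from measurable_compose[OF this borel_measurable_cost_function[OF c]] show ?thesis by simp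
  qed
  from L_cases show ?thesis
  proof
    assume "\<exists>l::real. \<forall>x. L x \<le> ereal l"
    then obtain l :: real where l: "\<And>x. L x \<le> ereal l" by blast
    have "AE x in \<eta>. c x (T x) \<le> ennreal (l / b - h x)"
      using hT
    proof eventually_elim
      case (elim x)
      have "L (T x) / ereal b \<le> ereal (l / b)"
        using ereal_divide_right_mono[OF l, of "ereal b"] b by simp
      with elim show ?case
        by (cases "c x (T x)" rule: ennreal_cases; cases "L (T x) / ereal b")
          (auto intro!: ennreal_leI)
    qed
    then have "(\<integral>\<^sup>+ x. c x (T x) \<partial>\<eta>) \<le> (\<integral>\<^sup>+ x. ennreal (l / b - h x) \<partial>\<eta>)"
      by (rule nn_integral_mono_AE)
    also have "\<dots> < \<infinity>"
    proof -
      have "integrable \<eta> (\<lambda>x. l / b - h x)" using h by simp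
      then show ?thesis by (simp add: real_integrable_def less_top)
    qed
    finally have "(\<integral>\<^sup>+ x. c x (T x) \<partial>\<eta>) < \<infinity>" .
    moreover have "ereal r < ereal (LINT x|\<eta>. h x)" using rh by simp
    then have "ereal r < expect \<eta> (\<lambda>x. L (T x) / ereal b - enn2ereal (c x (T x)))"
      unfolding expect_ereal[OF h, symmetric]
      by (rule less_le_trans) (use hT in \<open>auto intro!: expect_mono_AE elim!: eventually_mono\<close>)
    ultimately show ?thesis using T by blast
  next
    \<comment> \<open>Without an upper bound on \<open>L\<close> the cost of \<open>T\<close> may be infinite, so mass whose transport
      costs more than \<open>m\<close> stays where it is.\<close>
    assume "\<exists>l::real. \<forall>x. ereal l \<le> L x"
    then obtain l :: real where l: "\<And>x. ereal l \<le> L x" by blast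
    \<comment> \<open>A lower bound for the integrand along the truncated transport
      \<open>S\<close>: \<open>h x\<close> where mass moves, and l/b where it stays at zero
      cost.\<close>
    define k where "k m x = (if c x (T x) \<le> of_nat m then h x else l / b)" for m x
    have k_meas [measurable]: "k m \<in> borel_measurable \<eta>" for m
      unfolding k_def by measurable
    have dom_int: "integrable \<eta> (\<lambda>x. \<bar>h x\<bar> + \<bar>l / b\<bar>)" using h by simp
    have dom: "AE x in \<eta>. norm (k m x) \<le> \<bar>h x\<bar> + \<bar>l / b\<bar>" for m
      by (auto simp: k_def)
    have k_int: "integrable \<eta> (k m)" for m
      by (rule Bochner_Integration.integrable_bound[OF dom_int]) (use dom[of m] in auto)
    have "(\<lambda>m. LINT x|\<eta>. k m x) \<longlonglongrightarrow> (LINT x|\<eta>. h x)"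
    proof (rule integral_dominated_convergence[OF _ _ dom_int _ dom])
      show "AE x in \<eta>. (\<lambda>m. k m x) \<longlonglongrightarrow> h x"
        using hT
      proof eventually_elim
        case (elim x)
        \<comment> \<open>As \<open>L\<close> never takes the value infinity, an infinite cost would
          make the integrand minus infinity, against \<open>hT\<close>.\<close>
        have "c x (T x) < top"
          using elim L_not_inf[of "T x"] b
          by (cases "c x (T x)" rule: ennreal_cases; cases "L (T x)") auto
        then obtain N where N: "c x (T x) < of_nat N"
          using ennreal_Ex_less_of_nat by blast
        have "k m x = h x" if "m \<ge> N" for m
        proof -
          have "c x (T x) \<le> of_nat m"
            by (rule order_trans[OF less_imp_le[OF N] of_nat_mono[OF that]])
          then show ?thesis by (simp add: k_def)
        qed
        then show ?case
          by (intro tendsto_eventually) (auto simp: eventually_sequentially)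
      qed
    qed auto
    from order_tendstoD(1)[OF this rh] obtain m where m: "r < (LINT x|\<eta>. k m x)"
      by (auto simp: eventually_sequentially)
    define S where "S x = (if c x (T x) \<le> of_nat m then T x else x)" for x
    have S [measurable]: "S \<in> borel_measurable borel"
      unfolding S_def by measurable
    have "(\<integral>\<^sup>+ x. c x (S x) \<partial>\<eta>) \<le> (\<integral>\<^sup>+ x. of_nat m \<partial>\<eta>)"
      by (intro nn_integral_mono) (simp add: S_def c_diag)
    also have "\<dots> < \<infinity>" by (simp add: emeasure_space_1 less_top[symmetric])
    finally have "(\<integral>\<^sup>+ x. c x (S x) \<partial>\<eta>) < \<infinity>" .
    moreover have "ereal r < ereal (LINT x|\<eta>. k m x)" using m by simp
    then have "ereal r < expect \<eta> (\<lambda>x. L (S x) / ereal b - enn2ereal (c x (S x)))"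
      unfolding expect_ereal[OF k_int, symmetric]
    proof (rule less_le_trans, intro expect_mono_AE)
      show "AE x in \<eta>. ereal (k m x) \<le> L (S x) / ereal b - enn2ereal (c x (S x))"
        using hT
      proof eventually_elim
        case (elim x)
        have "ereal (l / b) \<le> L x / ereal b"
          using ereal_divide_right_mono[OF l, of "ereal b"] b by simp
        with less_imp_le[OF elim] show ?case
          by (auto simp: k_def S_def c_diag zero_ennreal.rep_eq)
      qed
    qed
    ultimately show ?thesis using S by blast
  qed
qed

lemma OT_reg_loss_approx_coupling:
  fixes \<eta> :: "'a::polish_space measure"
  assumes \<eta>: "prob_space \<eta>" and sets: "sets \<eta> = sets borel"
    and L: "L \<in> borel_measurable borel" and L_not_inf: "\<And>x. L x \<noteq> \<infinity>"
    and L_cases: "(\<exists>l::real. \<forall>x. ereal l \<le> L x) \<or> (\<exists>l::real. \<forall>x. L x \<le> ereal l)"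
    and c: "cost_function c" and c_diag: "\<And>x. c x x = 0" and b: "b > 0"
    and r: "ereal r < expect \<eta> (OT_reg_loss L c b)"
  shows "\<exists>\<pi>. prob_space \<pi> \<and> sets \<pi> = sets borel \<and> distr \<pi> borel fst = \<eta> \<and>
    (\<integral>\<^sup>+ p. c (fst p) (snd p) \<partial>\<pi>) < \<infinity> \<and>
    ereal r < expect \<pi> (\<lambda>p. L (snd p) / ereal b - enn2ereal (c (fst p) (snd p)))"
proof -
  note [measurable_cong] = sets
  obtain S where S [measurable]: "S \<in> borel_measurable borel"
    and fin: "(\<integral>\<^sup>+ x. c x (S x) \<partial>\<eta>) < \<infinity>"
    and gt: "ereal r < expect \<eta> (\<lambda>x. L (S x) / ereal b - enn2ereal (c x (S x)))"
    using OT_reg_loss_approx_transport[OF assms] by blast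
  have pair: "(\<lambda>x. (x, S x)) \<in> \<eta> \<rightarrow>\<^sub>M borel" by measurable
  let ?\<pi> = "distr \<eta> borel (\<lambda>x. (x, S x))"
  have "distr ?\<pi> borel fst = distr \<eta> borel (\<lambda>x. x)"
    by (subst distr_distr[OF _ pair]) (simp_all add: o_def measurable_fst_snd_borel)
  also have "\<dots> = \<eta>" using sets by (rule distr_id2[OF sym])
  finally have "distr ?\<pi> borel fst = \<eta>" .
  moreover have "(\<integral>\<^sup>+ p. c (fst p) (snd p) \<partial>?\<pi>) < \<infinity>"
    using fin borel_measurable_cost_function[OF c] by (simp add: nn_integral_distr[OF pair])
  moreover have "ereal r < expect ?\<pi> (\<lambda>p. L (snd p) / ereal b - enn2ereal (c (fst p) (snd p)))"
    using gt borel_measurable_OT_integrand[OF L c] by (simp add: expect_distr[OF pair])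
  moreover have "prob_space ?\<pi>"
    using prob_space.prob_space_distr[OF \<eta> pair] .
  ultimately show ?thesis by (intro exI[of _ ?\<pi>]) simp
qed

subsection \<open>Duality\<close>

text \<open>A Lagrange multiplier in the plane, found by comparing slopes. Chords from (e, m) to
  points on the right are no steeper than chords to points on the left, since otherwise convexity
  would yield a point above \<open>m\<close> that satisfies the constraint. The Slater point
  \<open>p0\<close> bounds the right slopes, and \<open>l\<close> is their supremum.\<close>

lemma convex_separation_multiplier:
  fixes S :: "(real \<times> real) set"
  assumes convex: "\<And>p q t. p \<in> S \<Longrightarrow> q \<in> S \<Longrightarrow> 0 \<le> t \<Longrightarrow> t \<le> 1 \<Longrightarrow>
      \<exists>r\<in>S. fst r \<le> t * fst p + (1 - t) * fst q \<and> t * snd p + (1 - t) * snd q \<le> snd r"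
    and slater: "p0 \<in> S" "fst p0 < e"
    and bound: "\<And>p. p \<in> S \<Longrightarrow> fst p \<le> e \<Longrightarrow> snd p \<le> m"
  shows "\<exists>l\<ge>0. \<forall>p\<in>S. snd p \<le> m + l * (fst p - e)"
proof -
  \<comment> \<open>Including 0 makes the supremum nonnegative and covers the case of no points to
    the right of \<open>e\<close>.\<close>
  define A where "A = insert 0 ((\<lambda>p. (snd p - m) / (fst p - e)) ` {p \<in> S. e < fst p})"
  have A_le: "a \<le> (m - snd q) / (e - fst q)" if a: "a \<in> A" and q: "q \<in> S" "fst q < e" for a q
  proof -
    have "snd q \<le> m" using bound q by simp
    from a consider "a = 0" | p where "p \<in> S" "e < fst p" "a = (snd p - m) / (fst p - e)"
      by (auto simp: A_def)
    then show ?thesis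
    proof cases
      case 1
      with q \<open>snd q \<le> m\<close> show ?thesis by simp
    next
      case 2
      \<comment> \<open>The weight that places the combination of \<open>p\<close> and
        \<open>q\<close> exactly at first coordinate \<open>e\<close>.\<close>
      define t where "t = (e - fst q) / (fst p - fst q)"
      have t: "0 \<le> t" "t \<le> 1" "1 - t = (fst p - e) / (fst p - fst q)"
        using 2 q by (auto simp: t_def field_simps)
      obtain r where r: "r \<in> S" "fst r \<le> t * fst p + (1 - t) * fst q"
        "t * snd p + (1 - t) * snd q \<le> snd r"
        using convex[OF \<open>p \<in> S\<close> \<open>q \<in> S\<close> t(1,2)] by blast
      have "t * fst p + (1 - t) * fst q = fst q + t * (fst p - fst q)"
        by (simp add: algebra_simps)
      also have "\<dots> = e" using 2 q by (simp add: t_def)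
      finally have "snd r \<le> m" using bound r by simp
      with r have "t * snd p + (1 - t) * snd q \<le> m" by simp
      then have "(t * snd p + (1 - t) * snd q) * (fst p - fst q) \<le> m * (fst p - fst q)"
        using 2 q by (intro mult_right_mono) auto
      moreover have tp: "t * (fst p - fst q) = e - fst q"
        using 2 q by (simp add: t_def)
      moreover have "(1 - t) * (fst p - fst q) = fst p - e"
        unfolding left_diff_distrib tp by simp
      moreover have "(t * snd p + (1 - t) * snd q) * (fst p - fst q) =
          t * (fst p - fst q) * snd p + (1 - t) * (fst p - fst q) * snd q"
        by (simp add: algebra_simps)
      ultimately have "(e - fst q) * snd p + (fst p - e) * snd q \<le> m * (fst p - fst q)"
        by simp
      then have "(snd p - m) / (fst p - e) \<le> (m - snd q) / (e - fst q)"
        using 2(2) q(2) by (simp add: field_simps)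
      with 2(3) show ?thesis by simp
    qed
  qed
  have bdd: "bdd_above A" using A_le slater by (intro bdd_aboveI) blast
  have "0 \<in> A" by (simp add: A_def)
  show ?thesis
  proof (intro exI[of _ "Sup A"] conjI ballI)
    show "0 \<le> Sup A" using \<open>0 \<in> A\<close> bdd by (rule cSup_upper)
    fix p assume p: "p \<in> S"
    consider "fst p < e" | "fst p = e" | "fst p > e" by linarith
    then show "snd p \<le> m + Sup A * (fst p - e)"
    proof cases
      case 1
      have "Sup A \<le> (m - snd p) / (e - fst p)"
        using A_le[OF _ p 1] \<open>0 \<in> A\<close> by (intro cSup_least) auto
      with 1 show ?thesis by (simp add: field_simps)
    next
      case 2
      with bound[OF p] show ?thesis by simp
    next
      case 3
      have "(snd p - m) / (fst p - e) \<le> Sup A"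
        using p 3 by (intro cSup_upper bdd) (auto simp: A_def)
      with 3 show ?thesis by (simp add: field_simps)
    qed
  qed
qed

section \<open>The regularized divergence in terms of couplings\<close>

lemma OT_reg_div_le:
  assumes "prob_space \<pi>" "sets \<pi> = sets borel"
  shows "OT_reg_div D c (distr \<pi> borel snd) P \<le>
    D (distr \<pi> borel fst) P + (\<integral>\<^sup>+ p. c (fst p) (snd p) \<partial>\<pi>)"
proof -
  note [measurable_cong] = assms(2)
  have "fst \<in> \<pi> \<rightarrow>\<^sub>M borel" by measurable
  from prob_space.prob_space_distr[OF assms(1) this]
  have "distr \<pi> borel fst \<in> Prob"
    by (simp add: Prob_def)
  moreover have "\<pi> \<in> couplings (distr \<pi> borel fst) (distr \<pi> borel snd)"
    using assms by (simp add: couplings_def)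
  ultimately have "OT_cost c (distr \<pi> borel fst) (distr \<pi> borel snd) \<le> (\<integral>\<^sup>+ p. c (fst p) (snd p) \<partial>\<pi>)"
    unfolding OT_cost_def by (intro INF_lower)
  with \<open>distr \<pi> borel fst \<in> Prob\<close> show ?thesis
    unfolding OT_reg_div_def by (intro INF_lower2[of "distr \<pi> borel fst"] add_left_mono)
qed

text \<open>Unfolds the two nested infima one after the other. The divergence term is finite because
  it lies below \<open>x\<close>, so it can be moved across the strict inequality; the intermediate
  measure survives as the first marginal of \<open>\<pi>\<close>.\<close>

lemma OT_reg_div_less_ex:
  assumes "OT_reg_div D c Q P < x"
  obtains \<pi> where "prob_space \<pi>" "sets \<pi> = sets borel" "distr \<pi> borel snd = Q"
    "D (distr \<pi> borel fst) P + (\<integral>\<^sup>+ p. c (fst p) (snd p) \<partial>\<pi>) < x"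
proof -
  obtain \<eta> where \<eta>: "D \<eta> P + OT_cost c \<eta> Q < x"
    using assms by (auto simp: OT_reg_div_def INF_less_iff)
  have "D \<eta> P \<le> D \<eta> P + OT_cost c \<eta> Q" by simp
  also note \<eta>
  also have "x \<le> top" by simp
  finally have "D \<eta> P < top" .
  with \<eta> have "OT_cost c \<eta> Q < x - D \<eta> P"
    by (simp add: less_diff_eq_ennreal add.commute)
  then obtain \<pi> where "\<pi> \<in> couplings \<eta> Q" "(\<integral>\<^sup>+ p. c (fst p) (snd p) \<partial>\<pi>) < x - D \<eta> P"
    by (auto simp: OT_cost_def INF_less_iff)
  with \<open>D \<eta> P < top\<close> show thesis
    using that[of \<pi>] by (auto simp: couplings_def less_diff_eq_ennreal add.commute)
qed

text \<open>The diagonal coupling of \<open>P\<close> has zero divergence and zero cost and will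
  serve as the Slater point.\<close>

lemma distr_diagonal:
  fixes P :: "'a::{topological_space, second_countable_topology} measure"
  assumes "prob_space P" "sets P = sets borel"
  defines "\<pi> \<equiv> distr P borel (\<lambda>x. (x, x))"
  shows "prob_space \<pi>" "sets \<pi> = sets borel" "distr \<pi> borel fst = P" "distr \<pi> borel snd = P"
proof -
  note [measurable_cong] = assms(2)
  have m: "(\<lambda>x. (x, x)) \<in> P \<rightarrow>\<^sub>M borel" by measurable
  show "prob_space \<pi>" "sets \<pi> = sets borel"
    using prob_space.prob_space_distr[OF assms(1) m] by (simp_all add: \<pi>_def)
  have "distr P borel (\<lambda>x. x) = P" using assms(2) by (rule distr_id2[OF sym])
  then show "distr \<pi> borel fst = P" "distr \<pi> borel snd = P"
    unfolding \<pi>_def by (subst distr_distr[OF _ m]; simp add: o_def measurable_fst_snd_borel)+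
qed

lemma nn_integral_diagonal:
  fixes P :: "'a::{topological_space, second_countable_topology} measure"
  assumes "sets P = sets borel" "cost_function c" "\<And>x. c x x = 0"
  shows "(\<integral>\<^sup>+ p. c (fst p) (snd p) \<partial>distr P borel (\<lambda>x. (x, x))) = 0"
proof -
  note [measurable_cong] = assms(1)
  have m: "(\<lambda>x. (x, x)) \<in> P \<rightarrow>\<^sub>M borel" by measurable
  show ?thesis
    using borel_measurable_cost_function[OF assms(2)] assms(3) by (simp add: nn_integral_distr[OF m])
qed

theorem theorem7:
  fixes P :: "'a::polish_space measure"
    and L :: "'a \<Rightarrow> ereal"
    and D :: "'a measure \<Rightarrow> 'a measure \<Rightarrow> ennreal"
    and c :: "'a \<Rightarrow> 'a \<Rightarrow> ennreal"
    and \<epsilon> \<kappa> :: real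
  assumes P: "P \<in> Prob"
    and L_meas: "L \<in> borel_measurable borel"
    and L_not_inf: "\<forall>x. L x \<noteq> \<infinity>"
    and L_cases: "(\<exists>b::real. \<forall>x. ereal b \<le> L x) \<or>
                  ((\<exists>b::real. \<forall>x. L x \<le> ereal b) \<and>
                   (\<integral>\<^sup>+ x. e2ennreal (- L x) \<partial>P) < \<infinity>)"
    and D: "pre_divergence D"
    and D_convex: "convex_in_first D P"
    and c: "cost_function c"
    and c_diag: "\<forall>x. c x x = 0"
    and eps: "\<epsilon> > 0"
    and kappa: "\<kappa> \<ge> 0"
  shows "(SUP Q\<in>{Q\<in>Prob. OT_reg_div D c Q P \<le> ennreal \<epsilon>}.
            expect (completion Q) L - ereal \<kappa> * enn2ereal (OT_reg_div D c Q P))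
       = (INF lam\<in>{0<..}. ereal (lam * \<epsilon>) + ereal (lam + \<kappa>) *
            (SUP Q\<in>{Q\<in>Prob. D Q P < \<infinity>}.
               expect (completion Q) (OT_reg_loss L c (lam + \<kappa>)) - enn2ereal (D Q P)))"
proof -

  \<comment> \<open>One-sided integrability of the loss\<close>
  note c_diag' = c_diag[rule_format] and L_not_inf' = L_not_inf[rule_format]
  have P_prob: "prob_space P" and P_sets: "sets P = sets borel" using P by (auto simp: Prob_def)
  have L_bdd: "(\<exists>l::real. \<forall>x. ereal l \<le> L x) \<or> (\<exists>l::real. \<forall>x. L x \<le> ereal l)"
    using L_cases by blast
  \<comment> \<open>The bound on \<open>L\<close> fixes one part that is finite under every
    probability measure, as \<open>expect_mixture\<close> demands.\<close>
  have semi: "(\<forall>Q\<in>Prob. (\<integral>\<^sup>+ x. e2ennreal (L x) \<partial>Q) < \<infinity>) \<or> (\<forall>Q\<in>Prob. (\<integral>\<^sup>+ x. e2ennreal (- L x) \<partial>Q) < \<infinity>)"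
    using L_bdd
  proof
    assume "\<exists>l::real. \<forall>x. ereal l \<le> L x"
    then obtain l :: real where "\<And>x. - L x \<le> ereal (- l)"
      by (metis ereal_minus_le_minus uminus_ereal.simps(1))
    then show ?thesis
      using nn_integral_lt_top_bounded[where f = "\<lambda>x. - L x"] by (auto simp: Prob_def)
  next
    assume "\<exists>l::real. \<forall>x. L x \<le> ereal l"
    then show ?thesis
      using nn_integral_lt_top_bounded[where f = L] by (auto simp: Prob_def)
  qed
  \<comment> \<open>For a loss bounded above, the integrability of its negative part under
    \<open>P\<close> enters here. It keeps the value at the Slater point above minus
    infinity.\<close>
  have EP: "expect P L \<noteq> - \<infinity>"
  proof -
    have "(\<integral>\<^sup>+ x. e2ennreal (- L x) \<partial>P) < \<infinity>"
      using L_cases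
    proof
      assume "\<exists>l::real. \<forall>x. ereal l \<le> L x"
      then obtain l :: real where "\<And>x. - L x \<le> ereal (- l)"
        by (metis ereal_minus_le_minus uminus_ereal.simps(1))
      then show ?thesis
        using nn_integral_lt_top_bounded[where f = "\<lambda>x. - L x", OF P_prob] by blast
    qed blast
    then show ?thesis
      by (cases "\<integral>\<^sup>+ x. e2ennreal (- L x) \<partial>P" rule: ennreal_cases;
          cases "\<integral>\<^sup>+ x. e2ennreal (L x) \<partial>P" rule: ennreal_cases) (auto simp: expect_def)
  qed

  \<comment> \<open>Admissible couplings and their convexity\<close>
  define w where "w \<pi> = (\<integral>\<^sup>+ p. c (fst p) (snd p) \<partial>\<pi>)" for \<pi> :: "('a \<times> 'a) measure"
  define E where "E \<pi> = expect (distr \<pi> borel snd) L" for \<pi> :: "('a \<times> 'a) measure"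
  define adm where "adm \<pi> \<longleftrightarrow> prob_space \<pi> \<and> sets \<pi> = sets borel \<and>
    D (distr \<pi> borel fst) P < \<infinity> \<and> w \<pi> < \<infinity>" for \<pi>
  \<comment> \<open>Since \<open>enn2real\<close> sends infinity to 0, this is the total cost for
    admissible couplings only.\<close>
  define g where "g \<pi> = enn2real (D (distr \<pi> borel fst) P) + enn2real (w \<pi>)" for \<pi>
  have g: "ennreal (g \<pi>) = D (distr \<pi> borel fst) P + w \<pi>" "0 \<le> g \<pi>" if "adm \<pi>" for \<pi>
    using that by (auto simp: g_def adm_def)
  have marg: "distr \<pi> borel fst \<in> Prob" "distr \<pi> borel snd \<in> Prob"
    if "prob_space \<pi>" "sets \<pi> = sets borel" for \<pi> :: "('a \<times> 'a) measure"
  proof -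
    note [measurable_cong] = that(2)
    have "fst \<in> \<pi> \<rightarrow>\<^sub>M borel" "snd \<in> \<pi> \<rightarrow>\<^sub>M borel" by measurable
    from this[THEN prob_space.prob_space_distr[OF that(1)]]
    show "distr \<pi> borel fst \<in> Prob" "distr \<pi> borel snd \<in> Prob"
      by (simp_all add: Prob_def)
  qed
  have semi_snd: "(\<integral>\<^sup>+ x. e2ennreal (L x) \<partial>distr \<pi> borel snd) < \<infinity> \<or>
      (\<integral>\<^sup>+ x. e2ennreal (- L x) \<partial>distr \<pi> borel snd) < \<infinity>"
    if "prob_space \<pi>" "sets \<pi> = sets borel" for \<pi> :: "('a \<times> 'a) measure"
    using semi marg(2)[OF that] by blast

  define \<pi>0 where "\<pi>0 = distr P borel (\<lambda>x. (x, x))"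
  note \<pi>0 = distr_diagonal[OF P_prob P_sets, folded \<pi>0_def]
  have w0: "w \<pi>0 = 0"
    unfolding w_def \<pi>0_def using nn_integral_diagonal[OF P_sets c c_diag'] .
  have DPP: "D P P = 0" using D P by (auto simp: pre_divergence_def)
  have adm0: "adm \<pi>0" and g0: "g \<pi>0 = 0" and E0: "E \<pi>0 = expect P L"
    using \<pi>0 w0 DPP by (simp_all add: adm_def g_def E_def)

  \<comment> \<open>Marginals, transport cost and expected loss are affine in the coupling, while
    the divergence of the first marginal is convex.\<close>
  have mix: "adm (mixture t \<pi>1 \<pi>2) \<and> g (mixture t \<pi>1 \<pi>2) \<le> t * g \<pi>1 + (1 - t) * g \<pi>2 \<and>
      E (mixture t \<pi>1 \<pi>2) = ereal t * E \<pi>1 + ereal (1 - t) * E \<pi>2"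
    if 1: "adm \<pi>1" and 2: "adm \<pi>2" and t: "0 \<le> t" "t \<le> 1" for t \<pi>1 \<pi>2
  proof -
    let ?\<pi> = "mixture t \<pi>1 \<pi>2"
    have sets: "sets \<pi>1 = sets borel" "sets \<pi>2 = sets borel"
      and prob: "prob_space \<pi>1" "prob_space \<pi>2"
      using 1 2 by (auto simp: adm_def)
    have w: "w ?\<pi> = ennreal t * w \<pi>1 + ennreal (1 - t) * w \<pi>2"
      unfolding w_def using sets borel_measurable_cost_function[OF c] by (rule nn_integral_mixture)
    have fst: "distr ?\<pi> borel fst = mixture t (distr \<pi>1 borel fst) (distr \<pi>2 borel fst)"
      and snd: "distr ?\<pi> borel snd = mixture t (distr \<pi>1 borel snd) (distr \<pi>2 borel snd)"
      using sets by (simp_all add: distr_mixture measurable_fst_snd_borel)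
    have D: "D (distr ?\<pi> borel fst) P \<le>
        ennreal t * D (distr \<pi>1 borel fst) P + ennreal (1 - t) * D (distr \<pi>2 borel fst) P"
      unfolding fst using D_convex marg(1) prob sets t by (auto simp: convex_in_first_def)
    obtain d1 d2 w1 w2 where fin: "D (distr \<pi>1 borel fst) P = ennreal d1" "D (distr \<pi>2 borel fst) P = ennreal d2"
      "w \<pi>1 = ennreal w1" "w \<pi>2 = ennreal w2" "d1 \<ge> 0" "d2 \<ge> 0" "w1 \<ge> 0" "w2 \<ge> 0"
      using 1 2 unfolding adm_def by (metis ennreal_cases infinity_ennreal_def less_irrefl)
    have w': "w ?\<pi> = ennreal (t * w1 + (1 - t) * w2)"
      unfolding w fin using fin t by (simp add: ennreal_mult' ennreal_plus)
    have D': "D (distr ?\<pi> borel fst) P \<le> ennreal (t * d1 + (1 - t) * d2)"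
      using D unfolding fin using fin t by (simp add: ennreal_mult' ennreal_plus)
    have "adm ?\<pi>"
      using prob sets t w' D' unfolding adm_def
      by (auto simp: prob_space_mixture intro: le_less_trans)
    moreover have "g ?\<pi> \<le> t * g \<pi>1 + (1 - t) * g \<pi>2"
    proof -
      have "enn2real (D (distr ?\<pi> borel fst) P) \<le> t * d1 + (1 - t) * d2"
        using enn2real_mono[OF D'] fin t by (simp del: ennreal_plus)
      moreover have "enn2real (w ?\<pi>) = t * w1 + (1 - t) * w2"
        using w' fin t by (simp del: ennreal_plus)
      ultimately show ?thesis
        using fin by (simp add: g_def algebra_simps)
    qed
    moreover have "E ?\<pi> = ereal t * E \<pi>1 + ereal (1 - t) * E \<pi>2"
      unfolding E_def snd using semi marg(2)[OF prob(1) sets(1)] marg(2)[OF prob(2) sets(2)]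
      by (intro expect_mixture L_meas t) auto
    ultimately show ?thesis by blast
  qed

  define Z where "Z b = (SUP Q\<in>{Q\<in>Prob. D Q P < \<infinity>}.
    expect (completion Q) (OT_reg_loss L c b) - enn2ereal (D Q P))" for b
  define Lhs where "Lhs = (SUP Q\<in>{Q\<in>Prob. OT_reg_div D c Q P \<le> ennreal \<epsilon>}.
    expect (completion Q) L - ereal \<kappa> * enn2ereal (OT_reg_div D c Q P))"
  \<comment> \<open>The second marginal is feasible, and its objective is at least that of the
    coupling because \<open>g \<pi>\<close> dominates the regularized divergence and \<kappa> is
    nonnegative.\<close>
  have Lhs_lower: "E \<pi> - ereal (\<kappa> * g \<pi>) \<le> Lhs" if "adm \<pi>" "g \<pi> \<le> \<epsilon>" for \<pi>
  proof -
    let ?Q = "distr \<pi> borel snd"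
    have "OT_reg_div D c ?Q P \<le> ennreal (g \<pi>)"
      unfolding g(1)[OF that(1)] w_def using that(1) by (intro OT_reg_div_le) (auto simp: adm_def)
    moreover have "\<dots> \<le> ennreal \<epsilon>" using that(2) by (rule ennreal_leI)
    ultimately have Q: "?Q \<in> {Q\<in>Prob. OT_reg_div D c Q P \<le> ennreal \<epsilon>}"
      and le: "OT_reg_div D c ?Q P \<le> ennreal (g \<pi>)"
      using marg(2) that(1) by (auto simp: adm_def)
    have "ereal \<kappa> * enn2ereal (OT_reg_div D c ?Q P) \<le> ereal (\<kappa> * g \<pi>)"
      using le kappa g(2)[OF that(1)]
      by (cases "OT_reg_div D c ?Q P" rule: ennreal_cases) (auto intro: mult_left_mono simp: top_unique)
    then have "E \<pi> - ereal (\<kappa> * g \<pi>) \<le> expect ?Q L - ereal \<kappa> * enn2ereal (OT_reg_div D c ?Q P)"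
      unfolding E_def by (intro ereal_minus_mono) auto
    also have "\<dots> \<le> Lhs"
      unfolding Lhs_def using Q by (intro SUP_upper2[OF Q]) (simp add: expect_completion)
    finally show ?thesis .
  qed

  \<comment> \<open>Weak duality\<close>
  have weak: "Lhs \<le> ereal (lam * \<epsilon>) + ereal (lam + \<kappa>) * Z (lam + \<kappa>)" if lam: "lam > 0" for lam
    unfolding Lhs_def
  proof (rule SUP_least)
    fix Q assume "Q \<in> {Q\<in>Prob. OT_reg_div D c Q P \<le> ennreal \<epsilon>}"
    then have Q: "Q \<in> Prob" "OT_reg_div D c Q P \<le> ennreal \<epsilon>" by auto
    obtain R where R: "OT_reg_div D c Q P = ennreal R" "0 \<le> R" "R \<le> \<epsilon>"
      using Q(2) eps by (cases "OT_reg_div D c Q P" rule: ennreal_cases) (auto simp: top_unique)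
    let ?b = "lam + \<kappa>"
    have b: "?b > 0" using lam kappa by simp
    \<comment> \<open>The slack \<open>e\<close> is there because the infimum defining the
      regularized divergence may not be attained.\<close>
    have step: "expect Q L - ereal (?b * (R + e)) \<le> ereal ?b * Z ?b" if e: "e > 0" for e :: real
    proof -
      have "OT_reg_div D c Q P < ennreal (R + e)"
        unfolding R using R(2) e by (simp add: ennreal_less_iff)
      then obtain \<pi> where \<pi>: "prob_space \<pi>" "sets \<pi> = sets borel" "distr \<pi> borel snd = Q"
        "D (distr \<pi> borel fst) P + w \<pi> < ennreal (R + e)"
        unfolding w_def by (rule OT_reg_div_less_ex)
      have "D (distr \<pi> borel fst) P < top" "w \<pi> < top"
        using \<pi>(4) by (auto dest!: less_trans[OF _ ennreal_less_top])
      then have adm: "adm \<pi>" using \<pi> by (simp add: adm_def)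
      have "ennreal (g \<pi>) < ennreal (R + e)"
        using \<pi>(4) unfolding g(1)[OF adm] .
      then have gR: "g \<pi> < R + e"
        using g(2)[OF adm] by (simp add: ennreal_less_iff)
      obtain d W where dW: "D (distr \<pi> borel fst) P = ennreal d" "w \<pi> = ennreal W" "d \<ge> 0" "W \<ge> 0"
        using adm unfolding adm_def by (metis ennreal_cases infinity_ennreal_def less_irrefl)
      have "expect Q L / ereal ?b - ereal W \<le> expect (distr \<pi> borel fst) (OT_reg_loss L c ?b)"
        using expect_OT_le_expect_OT_reg_loss[OF \<pi>(1,2) L_meas c b _ semi_snd[OF \<pi>(1,2)]] adm dW
        by (simp add: \<pi>(3) adm_def w_def)
      then have "expect Q L / ereal ?b - ereal W - ereal d \<le>
          expect (distr \<pi> borel fst) (OT_reg_loss L c ?b) - ereal d"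
        by (intro ereal_minus_mono) auto
      also have "\<dots> \<le> Z ?b"
        unfolding Z_def using adm marg(1)[OF \<pi>(1,2)] dW
        by (intro SUP_upper2[of "distr \<pi> borel fst"]) (auto simp: adm_def expect_completion)
      finally have Z: "expect Q L / ereal ?b - ereal W - ereal d \<le> Z ?b" .
      have gdW: "d + W < R + e" using gR dW by (simp add: g_def)
      show ?thesis
      proof (cases "expect Q L")
        case (real a)
        have "a - ?b * (R + e) \<le> a - ?b * (d + W)"
          using gdW b by (intro diff_left_mono mult_left_mono) auto
        also have "\<dots> = ?b * (a / ?b - W - d)"
          using b by (simp add: right_diff_distrib distrib_left)
        finally have "ereal (a - ?b * (R + e)) \<le> ereal ?b * ereal (a / ?b - W - d)" by simp
        also have "\<dots> \<le> ereal ?b * Z ?b"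
          using Z real b by (intro ereal_mult_left_mono) auto
        finally show ?thesis using real by simp
      next
        case PInf
        then have "Z ?b = \<infinity>" using Z b by simp
        then show ?thesis using b by simp
      qed simp
    qed
    have "expect Q L - ereal (?b * R) \<le> ereal ?b * Z ?b"
    proof (rule ereal_le_epsilon2)
      fix e :: real assume "e > 0"
      \<comment> \<open>The slack is divided by \<open>?b\<close>, so that multiplying by
        \<open>?b\<close> returns exactly \<open>e\<close>.\<close>
      then have "expect Q L - ereal (?b * (R + e / ?b)) \<le> ereal ?b * Z ?b"
        using b by (intro step) simp
      moreover have "?b * (R + e / ?b) = ?b * R + e"
        using b by (simp add: distrib_left)
      ultimately have "expect Q L - ereal (?b * R + e) \<le> ereal ?b * Z ?b" by simp
      then show "expect Q L - ereal (?b * R) \<le> ereal ?b * Z ?b + ereal e"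
        by (cases "expect Q L"; cases "ereal ?b * Z ?b") auto
    qed
    \<comment> \<open>Of the penalty (lam + \<kappa>) R the part with \<kappa> is kept in the
      objective, and the rest is absorbed by the constraint.\<close>
    moreover have "lam * R \<le> lam * \<epsilon>" using R lam by simp
    ultimately have "expect Q L - ereal (\<kappa> * R) \<le> ereal (lam * \<epsilon>) + ereal ?b * Z ?b"
      by (cases "expect Q L"; cases "ereal ?b * Z ?b") (auto simp: algebra_simps)
    then show "expect (completion Q) L - ereal \<kappa> * enn2ereal (OT_reg_div D c Q P) \<le>
        ereal (lam * \<epsilon>) + ereal ?b * Z ?b"
      using R by (simp add: expect_completion)
  qed

  \<comment> \<open>Strong duality\<close>
  have strong: "(INF lam\<in>{0<..}. ereal (lam * \<epsilon>) + ereal (lam + \<kappa>) * Z (lam + \<kappa>)) \<le> Lhs"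
  proof (cases Lhs)
    case MInf
    have "E \<pi>0 \<le> Lhs" using Lhs_lower[OF adm0] g0 eps by simp
    with MInf EP E0 show ?thesis by simp
  next
    case (real m)
    \<comment> \<open>Mixing a coupling of infinite expected loss with the diagonal one at a small
      weight would meet the constraint and force \<open>Lhs\<close> to be infinite.\<close>
    have E_fin: "E \<pi> \<noteq> \<infinity>" if \<pi>: "adm \<pi>" for \<pi>
    proof
      assume inf: "E \<pi> = \<infinity>"
      define t where "t = \<epsilon> / (g \<pi> + \<epsilon>)"
      have t: "0 < t" "t \<le> 1" "t * g \<pi> \<le> \<epsilon>"
        using eps g(2)[OF \<pi>] by (auto simp: t_def field_simps)
      note m = mix[OF \<pi> adm0 less_imp_le[OF t(1)] t(2)]
      have E_mix: "E (mixture t \<pi> \<pi>0) = \<infinity>"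
        using m inf E0 EP t by (cases "E \<pi>0") auto
      have "g (mixture t \<pi> \<pi>0) \<le> \<epsilon>" using m t g0 by simp
      from Lhs_lower[OF conjunct1[OF m] this] show False
        unfolding E_mix real by simp
    qed
    \<comment> \<open>Only real expected losses give points. The value infinity is ruled out by
      \<open>E_fin\<close>, and minus infinity does not occur for the couplings to which the
      multiplier is applied below.\<close>
    define S where "S = {(g \<pi>, a - \<kappa> * g \<pi>) | \<pi> a. adm \<pi> \<and> E \<pi> = ereal a}"
    obtain a0 where a0: "E \<pi>0 = ereal a0"
      using E_fin[OF adm0] EP unfolding E0 by (cases "expect P L") auto
    have "\<exists>l\<ge>0. \<forall>p\<in>S. snd p \<le> m + l * (fst p - \<epsilon>)"
    proof (rule convex_separation_multiplier[of S])
      fix p q t assume pq: "p \<in> S" "q \<in> S" and t: "0 \<le> t" "t \<le> (1::real)"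
      from pq obtain \<pi>1 a1 \<pi>2 a2 where 1: "adm \<pi>1" "E \<pi>1 = ereal a1" "p = (g \<pi>1, a1 - \<kappa> * g \<pi>1)"
        and 2: "adm \<pi>2" "E \<pi>2 = ereal a2" "q = (g \<pi>2, a2 - \<kappa> * g \<pi>2)"
        by (auto simp: S_def)
      let ?\<pi> = "mixture t \<pi>1 \<pi>2"
      note m = mix[OF 1(1) 2(1) t]
      have "(g ?\<pi>, (t * a1 + (1 - t) * a2) - \<kappa> * g ?\<pi>) \<in> S"
        using m 1 2 by (auto simp: S_def intro!: exI[of _ ?\<pi>])
      moreover have "\<kappa> * g ?\<pi> \<le> \<kappa> * (t * g \<pi>1 + (1 - t) * g \<pi>2)"
        using m kappa by (intro mult_left_mono) auto
      ultimately show "\<exists>r\<in>S. fst r \<le> t * fst p + (1 - t) * fst q \<and> t * snd p + (1 - t) * snd q \<le> snd r"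
        using m 1 2 by (intro bexI[of _ "(g ?\<pi>, (t * a1 + (1 - t) * a2) - \<kappa> * g ?\<pi>)"]) (auto simp: algebra_simps)
    next
      show "(0, a0) \<in> S" using a0 adm0 g0 by (auto simp: S_def intro!: exI[of _ \<pi>0])
      show "fst (0, a0) < \<epsilon>" using eps by simp
    next
      fix p assume "p \<in> S" "fst p \<le> \<epsilon>"
      then show "snd p \<le> m" using Lhs_lower real by (force simp: S_def)
    qed
    then obtain l where l: "l \<ge> 0" "\<And>p. p \<in> S \<Longrightarrow> snd p \<le> m + l * (fst p - \<epsilon>)"
      by blast
    \<comment> \<open>The dual variable must be positive while the multiplier \<open>l\<close> may
      vanish, so it is raised by \<open>d\<close>. If some \<eta> violated the bound, an almost
      optimal coupling with first marginal \<eta> would give a point of \<open>S\<close> above the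
      separating line.\<close>
    have Z_le: "Z (l + d + \<kappa>) \<le> ereal ((m - l * \<epsilon>) / (l + d + \<kappa>))" if d: "d > 0" for d :: real
      unfolding Z_def
    proof (rule SUP_least)
      let ?b = "l + d + \<kappa>"
      have b: "?b > 0" using l d kappa by simp
      fix \<eta> assume "\<eta> \<in> {Q\<in>Prob. D Q P < \<infinity>}"
      then have \<eta>: "prob_space \<eta>" "sets \<eta> = sets borel" "D \<eta> P < \<infinity>" by (auto simp: Prob_def)
      obtain d\<eta> where d\<eta>: "D \<eta> P = ennreal d\<eta>" "d\<eta> \<ge> 0"
        using \<eta>(3) by (cases "D \<eta> P" rule: ennreal_cases) auto
      let ?F = "expect \<eta> (OT_reg_loss L c ?b)"
      have "?F \<le> ereal ((m - l * \<epsilon>) / ?b + d\<eta>)"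
      proof (rule ccontr)
        assume "\<not> ?thesis"
        then obtain r where r: "(m - l * \<epsilon>) / ?b + d\<eta> < r" "ereal r < ?F"
          by (metis ereal_dense2 ereal_less(2) less_ereal.simps(1) not_le)
        obtain \<pi> where \<pi>: "prob_space \<pi>" "sets \<pi> = sets borel" "distr \<pi> borel fst = \<eta>" "w \<pi> < \<infinity>"
          and "ereal r < expect \<pi> (\<lambda>p. L (snd p) / ereal ?b - enn2ereal (c (fst p) (snd p)))"
          using OT_reg_loss_approx_coupling[OF \<eta>(1,2) L_meas L_not_inf' L_bdd c c_diag' b r(2)]
          unfolding w_def by blast
        then have rE: "ereal r < E \<pi> / ereal ?b - enn2ereal (w \<pi>)"
          unfolding E_def w_def using expect_OT_integrand[OF \<pi>(2) L_meas c b _ semi_snd[OF \<pi>(1,2)]] by simp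
        have adm: "adm \<pi>" using \<pi> \<eta> by (simp add: adm_def)
        obtain W where W: "w \<pi> = ennreal W" "W \<ge> 0"
          using \<pi>(4) by (cases "w \<pi>" rule: ennreal_cases) auto
        obtain a where a: "E \<pi> = ereal a"
          using E_fin[OF adm] rE W b by (cases "E \<pi>") auto
        have gW: "g \<pi> = d\<eta> + W" using W d\<eta> \<pi>(3) by (simp add: g_def)
        have "(g \<pi>, a - \<kappa> * g \<pi>) \<in> S" using adm a by (auto simp: S_def)
        from l(2)[OF this] have "a - \<kappa> * g \<pi> \<le> m + l * (g \<pi> - \<epsilon>)" by simp
        moreover have "0 \<le> d * g \<pi>" using d g(2)[OF adm] by simp
        ultimately have "a - ?b * g \<pi> \<le> m - l * \<epsilon>" by (simp add: algebra_simps)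
        moreover have "?b * (r + W) < a"
          using rE a W b by (simp add: field_simps)
        ultimately have "?b * (r - d\<eta>) < m - l * \<epsilon>"
          unfolding gW by (simp add: algebra_simps)
        moreover have "m - l * \<epsilon> < ?b * (r - d\<eta>)"
          using r(1) b by (simp add: field_simps)
        ultimately show False by simp
      qed
      then have "?F - ereal d\<eta> \<le> ereal ((m - l * \<epsilon>) / ?b + d\<eta>) - ereal d\<eta>"
        by (intro ereal_minus_mono) auto
      then show "expect (completion \<eta>) (OT_reg_loss L c ?b) - enn2ereal (D \<eta> P) \<le> ereal ((m - l * \<epsilon>) / ?b)"
        using d\<eta> by (simp add: expect_completion)
    qed
    show ?thesis
    proof (rule ereal_le_epsilon2)
      fix e :: real assume e: "e > 0"
      \<comment> \<open>Raising the multiplier by this amount costs exactly \<open>e\<close> in the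
        term that is linear in \<epsilon>.\<close>
      define d where "d = e / \<epsilon>"
      have d: "d > 0" using e eps by (simp add: d_def)
      let ?b = "l + d + \<kappa>"
      have b: "?b > 0" using l d kappa by simp
      have "(INF lam\<in>{0<..}. ereal (lam * \<epsilon>) + ereal (lam + \<kappa>) * Z (lam + \<kappa>)) \<le>
          ereal ((l + d) * \<epsilon>) + ereal ?b * Z ?b"
        using l d by (intro INF_lower) auto
      also have "\<dots> \<le> ereal ((l + d) * \<epsilon>) + ereal ?b * ereal ((m - l * \<epsilon>) / ?b)"
        using Z_le[OF d] b by (intro add_left_mono ereal_mult_left_mono) auto
      also have "\<dots> = ereal ((l + d) * \<epsilon> + (m - l * \<epsilon>))"
        using b by simp
      also have "(l + d) * \<epsilon> + (m - l * \<epsilon>) = m + e"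
        using eps by (simp add: d_def algebra_simps)
      finally show "(INF lam\<in>{0<..}. ereal (lam * \<epsilon>) + ereal (lam + \<kappa>) * Z (lam + \<kappa>)) \<le> Lhs + ereal e"
        using real by simp
    qed
  qed (simp)

  show ?thesis
    using weak strong unfolding Lhs_def Z_def by (intro antisym INF_greatest) auto
qed

end
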